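(* The Hall universal locally finite group does not have the strong topological Rokhlin property.
   Context: The Hall universal locally finite group is the unique (up to isomorphism) countably infinite locally finite group which contains every finite group as a subgroup and in which any two isomorphic finitely generated (equivalently, finite) subgroups are conjugate. $\mathcal{C}$ is the Cantor space and $\mathrm{Homeo}(\mathcal{C})$ is the topological group of its self-homeomorphisms with the uniform topology. For a countable group $G$, $\mathrm{Act}_G(\mathcal{C})$ is the Polish space of all continuous actions of $G$ on $\mathcal{C}$, identified with the set of homomorphisms $G\to\mathrm{Homeo}(\mathcal{C})$, a closed subset of $\mathrm{Homeo}(\mathcal{C})^G$ with the product topology. $G$ has the strong topological Rokhlin property if there is $\alpha\in\mathrm{Act}_G(\mathcal{C})$ whose conjugacy class $\{\phi\alpha\phi^{-1}:\phi\in\mathrm{Homeo}(\mathcal{C})\}$, where $(\phi\alpha\phi^{-1})(g)=\phi\alpha(g)\phi^{-1}$, is comeager in $\mathrm{Act}_G(\mathcal{C})$. *)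

theory Defs
  imports "HOL-Analysis.Analysis" "HOL-Algebra.Generated_Groups"
begin

section \<open>Hall's universal locally finite group\<close>

definition finitely_generated_subgroup :: "'a set \<Rightarrow> ('a, 'b) monoid_scheme \<Rightarrow> bool" where
  "finitely_generated_subgroup H G \<longleftrightarrow>
     (\<exists>S. finite S \<and> S \<subseteq> carrier G \<and> H = generate G S)"

definition locally_finite_group :: "('a, 'b) monoid_scheme \<Rightarrow> bool" where
  "locally_finite_group G \<longleftrightarrow>
     group G \<and> (\<forall>H. finitely_generated_subgroup H G \<longrightarrow> finite H)"

definition conjugate_subgroups :: "('a, 'b) monoid_scheme \<Rightarrow> 'a set \<Rightarrow> 'a set \<Rightarrow> bool" where
  "conjugate_subgroups G H K \<longleftrightarrow>
     (\<exists>g\<in>carrier G. K = (\<lambda>h. g \<otimes>\<^bsub>G\<^esub> h \<otimes>\<^bsub>G\<^esub> inv\<^bsub>G\<^esub> g) ` H)"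

text \<open>The finite groups \<open>F\<close> are quantified over the type \<open>nat monoid\<close>, since a formula cannot
  quantify over types; every finite group is isomorphic to one carried by a set of natural numbers
  (see \<open>hall_universal_group_contains_finite\<close> below).\<close>

definition hall_universal_group :: "('a, 'b) monoid_scheme \<Rightarrow> bool" where
  "hall_universal_group G \<longleftrightarrow>
     locally_finite_group G \<and> countable (carrier G) \<and> infinite (carrier G) \<and>
     (\<forall>F :: nat monoid. group F \<and> finite (carrier F) \<longrightarrow>
        (\<exists>H. subgroup H G \<and> F \<cong> G\<lparr>carrier := H\<rparr>)) \<and>
     (\<forall>H K. finitely_generated_subgroup H G \<and> finitely_generated_subgroup K G \<and>
        G\<lparr>carrier := H\<rparr> \<cong> G\<lparr>carrier := K\<rparr> \<longrightarrow> conjugate_subgroups G H K)"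

lemma finite_group_iso_nat:
  fixes F :: "('c, 'd) monoid_scheme"
  assumes F: "group F" and fin: "finite (carrier F)"
  shows "\<exists>F' :: nat monoid. group F' \<and> finite (carrier F') \<and> F \<cong> F'"
proof -
  interpret F: group F by (rule F)
  obtain f :: "'c \<Rightarrow> nat" where inj: "inj_on f (carrier F)"
    using finite_imp_inj_to_nat_seg[OF fin] by blast
  define g where "g = inv_into (carrier F) f"
  define F' :: "nat monoid" where
    "F' = \<lparr>carrier = f ` carrier F, mult = (\<lambda>x y. f (g x \<otimes>\<^bsub>F\<^esub> g y)), one = f \<one>\<^bsub>F\<^esub>\<rparr>"
  have gf: "g (f x) = x" if "x \<in> carrier F" for x
    using inj that by (simp add: g_def)
  have G': "group F'"
  proof (rule groupI)
    show "\<exists>y\<in>carrier F'. y \<otimes>\<^bsub>F'\<^esub> x = \<one>\<^bsub>F'\<^esub>" if x: "x \<in> carrier F'" for x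
    proof -
      obtain u where u: "u \<in> carrier F" "x = f u"
        using x by (auto simp: F'_def)
      then show ?thesis
        by (intro bexI[of _ "f (inv\<^bsub>F\<^esub> u)"]) (auto simp: F'_def gf)
    qed
  qed (auto simp: F'_def gf F.m_assoc)
  have "f \<in> iso F F'"
    using inj by (auto simp: iso_def hom_def F'_def gf bij_betw_def)
  then show ?thesis
    using G' fin by (intro exI[of _ F']) (auto simp: is_iso_def F'_def)
qed

lemma hall_universal_group_contains_finite:
  fixes F :: "('c, 'd) monoid_scheme"
  assumes "hall_universal_group G" "group F" "finite (carrier F)"
  shows "\<exists>H. subgroup H G \<and> F \<cong> G\<lparr>carrier := H\<rparr>"
proof -
  obtain F' :: "nat monoid" where F': "group F'" "finite (carrier F')" "F \<cong> F'"
    using finite_group_iso_nat assms(2,3) by blast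
  then obtain H where "subgroup H G" "F' \<cong> G\<lparr>carrier := H\<rparr>"
    using assms(1) by (auto simp: hall_universal_group_def)
  then show ?thesis
    using F'(3) iso_trans by blast
qed

section \<open>The Cantor space and its homeomorphism group\<close>

text \<open>The Cantor space is \<open>nat \<Rightarrow> bool\<close> with the product topology of the type class instance;
  \<open>cantor_dist\<close> is a compatible metric (see \<open>mtopology_of_cantor_metric\<close>).\<close>

type_synonym cantor = "nat \<Rightarrow> bool"

definition cantor_dist :: "cantor \<Rightarrow> cantor \<Rightarrow> real" where
  "cantor_dist x y = (if x = y then 0 else (1/2) ^ (LEAST n. x n \<noteq> y n))"

definition cantor_metric :: "cantor metric" where
  "cantor_metric = metric (UNIV, cantor_dist)"

lemma cantor_dist_less_iff:
  "cantor_dist x y < (1/2) ^ n \<longleftrightarrow> (\<forall>i\<le>n. x i = y i)"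
proof (cases "x = y")
  case False
  define m where "m = (LEAST k. x k \<noteq> y k)"
  have ex: "\<exists>k. x k \<noteq> y k" using False by auto
  have m: "x m \<noteq> y m" unfolding m_def by (rule LeastI_ex[OF ex])
  have below: "x k = y k" if "k < m" for k
    using not_less_Least that unfolding m_def by blast
  have "cantor_dist x y < (1/2) ^ n \<longleftrightarrow> n < m"
    using False by (simp add: cantor_dist_def m_def)
  also have "\<dots> \<longleftrightarrow> (\<forall>i\<le>n. x i = y i)"
    using m below by (meson le_less_trans not_le)
  finally show ?thesis .
qed (simp add: cantor_dist_def)

lemma cantor_dist_ultra:
  "cantor_dist x z \<le> max (cantor_dist x y) (cantor_dist y z)"
proof (cases "x = z")
  case False
  define m where "m = (LEAST k. x k \<noteq> z k)"
  have "x m \<noteq> z m" unfolding m_def by (rule LeastI_ex) (use False in auto)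
  then have "\<not> (cantor_dist x y < (1/2)^m \<and> cantor_dist y z < (1/2)^m)"
    by (auto simp: cantor_dist_less_iff)
  then show ?thesis
    using False by (auto simp: cantor_dist_def[of x z] m_def)
qed (simp add: cantor_dist_def le_max_iff_disj)

lemma Metric_space_cantor: "Metric_space UNIV cantor_dist"
proof
  show nonneg: "0 \<le> cantor_dist x y" for x y
    by (simp add: cantor_dist_def)
  show "cantor_dist x y = cantor_dist y x" for x y
    by (simp add: cantor_dist_def eq_commute)
  show "cantor_dist x y = 0 \<longleftrightarrow> x = y" for x y
    by (simp add: cantor_dist_def)
  show "cantor_dist x z \<le> cantor_dist x y + cantor_dist y z" for x y z
    using cantor_dist_ultra[of x z y] nonneg[of x y] nonneg[of y z] by linarith
qed

lemma mspace_cantor_metric [simp]: "mspace cantor_metric = UNIV"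
  and mdist_cantor_metric [simp]: "mdist cantor_metric = cantor_dist"
  by (simp_all add: cantor_metric_def Metric_space.mspace_metric Metric_space.mdist_metric
      Metric_space_cantor)

lemma mtopology_of_cantor_metric: "mtopology_of cantor_metric = euclidean"
proof -
  interpret M: Metric_space UNIV cantor_dist by (rule Metric_space_cantor)
  have "openin M.mtopology U \<longleftrightarrow> open U" for U
  proof
    assume U: "openin M.mtopology U"
    have "\<exists>T. open T \<and> x \<in> T \<and> T \<subseteq> U" if x: "x \<in> U" for x
    proof -
      obtain r where r: "r > 0" "M.mball x r \<subseteq> U"
        using U x by (auto simp: M.openin_mtopology)
      obtain n where n: "(1/2::real) ^ n < r"
        using real_arch_pow_inv[OF r(1), of "1/2"] by auto
      have "open {y::cantor. \<forall>i\<in>{..n}. y (id i) \<in> {x i}}"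
        by (rule product_topology_basis') (auto simp: open_discrete)
      moreover have "{y. \<forall>i\<in>{..n}. y (id i) \<in> {x i}} \<subseteq> U"
      proof
        fix y assume "y \<in> {y. \<forall>i\<in>{..n}. y (id i) \<in> {x i}}"
        then have "cantor_dist x y < (1/2) ^ n"
          by (auto simp: cantor_dist_less_iff)
        then show "y \<in> U" using n r(2) by (auto simp: subset_iff)
      qed
      ultimately show ?thesis by (intro exI conjI) auto
    qed
    then show "open U"
      by (meson open_subopen)
  next
    assume U: "open U"
    have "\<exists>r>0. M.mball x r \<subseteq> U" if x: "x \<in> U" for x
    proof -
      have "openin (product_topology (\<lambda>i::nat. euclidean::bool topology) UNIV) U"
        using U by (simp add: euclidean_product_topology)
      then obtain X where X: "x \<in> Pi\<^sub>E UNIV X" "finite {i. X i \<noteq> (UNIV::bool set)}" "Pi\<^sub>E UNIV X \<subseteq> U"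
        using product_topology_open_contains_basis[of "\<lambda>i::nat. euclidean::bool topology" UNIV U x] x
        by auto
      obtain n where n: "\<And>i. X i \<noteq> UNIV \<Longrightarrow> i \<le> n"
        using X(2) by (auto simp: finite_nat_set_iff_bounded_le)
      have "M.mball x ((1/2) ^ n) \<subseteq> U"
      proof
        fix y assume "y \<in> M.mball x ((1/2) ^ n)"
        then have "\<forall>i\<le>n. x i = y i" by (simp add: cantor_dist_less_iff)
        then have "y i \<in> X i" for i
          using n[of i] PiE_mem[OF X(1), of i] by (cases "X i = UNIV") simp_all
        then have "y \<in> Pi\<^sub>E UNIV X" by (simp add: PiE_UNIV_domain)
        then show "y \<in> U" using X(3) by (rule subsetD[rotated])
      qed
      then show ?thesis by (intro exI[of _ "(1/2)^n"]) auto
    qed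
    then show "openin M.mtopology U" by (auto simp: M.openin_mtopology)
  qed
  then show ?thesis
    unfolding mtopology_of_def topology_eq by simp
qed

definition cantor_homeos :: "(cantor \<Rightarrow> cantor) set" where
  "cantor_homeos = {f. homeomorphic_map euclidean euclidean f}"

definition homeo_group :: "(cantor \<Rightarrow> cantor) monoid" where
  "homeo_group = \<lparr>carrier = cantor_homeos, mult = (\<circ>), one = id\<rparr>"

text \<open>The metric of \<open>funspace\<close> is the supremum metric, so this is the topology of uniform
  convergence.\<close>

definition homeo_topology :: "(cantor \<Rightarrow> cantor) topology" where
  "homeo_topology = subtopology (mtopology_of (funspace UNIV cantor_metric)) cantor_homeos"

lemma cantor_dist_le_1: "cantor_dist x y \<le> 1"
  by (simp add: cantor_dist_def power_le_one)

lemma mspace_funspace_cantor: "mspace (funspace (UNIV :: 'c set) cantor_metric) = UNIV"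
proof -
  interpret M: Metric_space UNIV cantor_dist by (rule Metric_space_cantor)
  have "M.mbounded A" for A
    unfolding M.mbounded_def by (auto simp: subset_iff intro!: exI[of _ 1] cantor_dist_le_1)
  then show ?thesis
    by (auto simp: M.fspace_def)
qed

lemma mdist_funspace_cantor:
  "mdist (funspace UNIV cantor_metric) f g = (SUP x. cantor_dist (f x) (g x))"
  using mspace_funspace_cantor
  by (auto simp: Metric_space.fdist_def[OF Metric_space_cantor])

lemma topspace_homeo_topology: "topspace homeo_topology = cantor_homeos"
  by (simp add: homeo_topology_def mspace_funspace_cantor del: mspace_funspace)

lemma group_homeo_group: "group homeo_group"
proof (rule groupI)
  show "\<one>\<^bsub>homeo_group\<^esub> \<in> carrier homeo_group"
    by (simp add: homeo_group_def cantor_homeos_def)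
  show "f \<otimes>\<^bsub>homeo_group\<^esub> g \<in> carrier homeo_group"
    if "f \<in> carrier homeo_group" "g \<in> carrier homeo_group" for f g
    using that unfolding homeo_group_def cantor_homeos_def
    by (auto intro: homeomorphic_map_compose)
  show "\<exists>g\<in>carrier homeo_group. g \<otimes>\<^bsub>homeo_group\<^esub> f = \<one>\<^bsub>homeo_group\<^esub>"
    if f: "f \<in> carrier homeo_group" for f
  proof -
    obtain g where "homeomorphic_maps euclidean euclidean f g"
      using f by (auto simp: homeo_group_def cantor_homeos_def homeomorphic_map_maps)
    then have "g \<in> cantor_homeos" "g \<circ> f = id"
      by (auto simp: cantor_homeos_def homeomorphic_maps_map homeomorphic_maps_def fun_eq_iff)
    then show ?thesis by (auto simp: homeo_group_def)
  qed
qed (simp_all add: homeo_group_def comp_assoc)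

section \<open>Actions and the strong topological Rokhlin property\<close>

text \<open>A homomorphism is represented by its restriction to \<open>carrier G\<close> (it is \<open>undefined\<close>
  elsewhere), as required for points of a \<open>product_topology\<close> indexed by \<open>carrier G\<close>.\<close>

definition cantor_actions :: "('a, 'b) monoid_scheme \<Rightarrow> ('a \<Rightarrow> cantor \<Rightarrow> cantor) set" where
  "cantor_actions G = hom G homeo_group \<inter> extensional (carrier G)"

definition action_topology :: "('a, 'b) monoid_scheme \<Rightarrow> ('a \<Rightarrow> cantor \<Rightarrow> cantor) topology" where
  "action_topology G =
     subtopology (product_topology (\<lambda>_. homeo_topology) (carrier G)) (cantor_actions G)"

lemma topspace_action_topology: "topspace (action_topology G) = cantor_actions G"
  by (auto simp: action_topology_def topspace_homeo_topology cantor_actions_def hom_def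
      homeo_group_def PiE_def)

definition conjugate_action ::
    "('a, 'b) monoid_scheme \<Rightarrow> (cantor \<Rightarrow> cantor) \<Rightarrow> ('a \<Rightarrow> cantor \<Rightarrow> cantor) \<Rightarrow> 'a \<Rightarrow> cantor \<Rightarrow> cantor" where
  "conjugate_action G \<phi> \<alpha> =
     (\<lambda>g\<in>carrier G. \<phi> \<circ> \<alpha> g \<circ> inv_into UNIV \<phi>)"

definition conjugacy_class ::
    "('a, 'b) monoid_scheme \<Rightarrow> ('a \<Rightarrow> cantor \<Rightarrow> cantor) \<Rightarrow> ('a \<Rightarrow> cantor \<Rightarrow> cantor) set" where
  "conjugacy_class G \<alpha> = {conjugate_action G \<phi> \<alpha> | \<phi>. \<phi> \<in> cantor_homeos}"

definition nowhere_dense_in :: "'a topology \<Rightarrow> 'a set \<Rightarrow> bool" where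
  "nowhere_dense_in X S \<longleftrightarrow> S \<subseteq> topspace X \<and> X interior_of (X closure_of S) = {}"

definition meager_in :: "'a topology \<Rightarrow> 'a set \<Rightarrow> bool" where
  "meager_in X S \<longleftrightarrow> (\<exists>\<F>. countable \<F> \<and> (\<forall>T\<in>\<F>. nowhere_dense_in X T) \<and> S = \<Union>\<F>)"

definition comeager_in :: "'a topology \<Rightarrow> 'a set \<Rightarrow> bool" where
  "comeager_in X S \<longleftrightarrow> S \<subseteq> topspace X \<and> meager_in X (topspace X - S)"

definition strong_topological_Rokhlin :: "('a, 'b) monoid_scheme \<Rightarrow> bool" where
  "strong_topological_Rokhlin G \<longleftrightarrow>
     (\<exists>\<alpha>\<in>cantor_actions G. comeager_in (action_topology G) (conjugacy_class G \<alpha>))"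

lemma conjugacy_class_subset:
  assumes "group G" "\<alpha> \<in> cantor_actions G"
  shows "conjugacy_class G \<alpha> \<subseteq> cantor_actions G"
proof -
  interpret G: group G by (rule assms(1))
  have hom: "\<alpha> g \<in> cantor_homeos" "\<alpha> (g \<otimes>\<^bsub>G\<^esub> h) = \<alpha> g \<circ> \<alpha> h"
    if "g \<in> carrier G" "h \<in> carrier G" for g h
    using assms(2) that by (auto simp: cantor_actions_def hom_def homeo_group_def)
  have "conjugate_action G \<phi> \<alpha> \<in> cantor_actions G" if \<phi>: "\<phi> \<in> cantor_homeos" for \<phi>
  proof -
    define \<psi> where "\<psi> = inv_into UNIV \<phi>"
    obtain \<psi>' where \<psi>': "homeomorphic_maps euclidean euclidean \<phi> \<psi>'"
      using \<phi> by (auto simp: cantor_homeos_def homeomorphic_map_maps)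
    then have 1: "\<psi>' (\<phi> x) = x" "\<phi> (\<psi>' x) = x" for x
      by (auto simp: homeomorphic_maps_def)
    then have "inj \<phi>"
      by (metis injI)
    then have "\<psi> = \<psi>'"
      unfolding \<psi>_def using 1 by (metis inv_f_eq ext)
    then have homeo: "\<psi> \<in> cantor_homeos" and \<psi>: "\<And>x. \<psi> (\<phi> x) = x"
      using \<psi>' 1 by (auto simp: cantor_homeos_def homeomorphic_maps_map)
    have "\<phi> \<circ> \<alpha> g \<circ> \<psi> \<in> cantor_homeos" if "g \<in> carrier G" for g
      using \<phi> homeo hom(1)[OF that that] unfolding cantor_homeos_def
      by (auto intro!: homeomorphic_map_compose)
    moreover have "\<phi> \<circ> \<alpha> (g \<otimes>\<^bsub>G\<^esub> h) \<circ> \<psi> = (\<phi> \<circ> \<alpha> g \<circ> \<psi>) \<circ> (\<phi> \<circ> \<alpha> h \<circ> \<psi>)"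
      if "g \<in> carrier G" "h \<in> carrier G" for g h
      using hom(2)[OF that] \<psi> by (simp add: comp_def)
    ultimately show ?thesis
      by (simp add: cantor_actions_def conjugate_action_def hom_def homeo_group_def
          flip: \<psi>_def)
  qed
  then show ?thesis
    by (auto simp: conjugacy_class_def)
qed

end

theory Submission
  imports Defs "HOL-Algebra.Elementary_Groups"
begin

text \<open>Let \<open>A\<close> be the clopen half \<open>{x. x 0}\<close> of the Cantor space and, for an action \<open>\<beta>\<close> of \<open>G\<close>, let
  \<open>D(\<beta>)\<close> be the set of those \<open>g\<close> for which \<open>\<beta> g\<close> does not map \<open>A\<close> into itself. Conjugating
  \<open>\<alpha>\<close> by \<open>\<phi>\<close> amounts to replacing \<open>A\<close> by the clopen set \<open>\<phi> -` A\<close>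
  (\<open>displacing_conjugate_action\<close>), and there are only countably many clopen sets
  (\<open>countable_homeo_preimages\<close>). So \<open>D\<close> takes only countably many values on a conjugacy class,
  and the class is covered by countably many fibres \<open>{\<beta>. D(\<beta>) = D}\<close>. These fibres are closed
  (\<open>closedin_displacing_fibre\<close>). For the Hall group they have empty interior
  (\<open>hall_interior_displacing_fibre\<close>), so every conjugacy class is meager. Because the space of
  actions is completely metrizable (\<open>completely_metrizable_action_topology\<close>), Baire's theorem
  forbids a meager set to be comeager.

  The interior is empty because \<open>D\<close> is not determined by finitely many approximate data. A basic
  neighbourhood of \<open>\<alpha>\<close> prescribes, up to a small error, the restriction of \<open>\<alpha>\<close> to a finite
  set. The subgroup \<open>F\<close> generated by this set is finite. Universality and
  homogeneity of the Hall group yield an involution \<open>t\<close> outside \<open>F\<close> that centralizes \<open>F\<close>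
  (\<open>hall_exists_centralizing_involution\<close>). It suffices to find two actions in the
  neighbourhood, one in which \<open>t\<close> moves a point of \<open>A\<close> out of \<open>A\<close>, and one in which \<open>t\<close>
  preserves \<open>A\<close>.

  Both are obtained by coinduction. Given an action \<open>\<rho>\<close> of a subgroup \<open>H\<close> on the Cantor space
  \<open>C\<close>, the group \<open>G\<close> acts by right translation on the space \<open>K\<close> of all \<open>H\<close>-equivariant maps
  \<open>z : G \<rightarrow> C\<close>, that is, \<open>z(hg) = \<rho>(h) z(g)\<close>, and evaluation at the identity maps \<open>K\<close> to
  \<open>C\<close> equivariantly for \<open>H\<close>. As \<open>K\<close> is a countable power of \<open>C\<close>, indexed by a transversal of
  the cosets \<open>Hg\<close>, it can be identified with \<open>C\<close>, and the identification can be chosen so that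
  the point that encodes \<open>z\<close> has the same first \<open>n\<close> coordinates as \<open>z(1)\<close>. The result is an action of \<open>G\<close> whose
  restriction to \<open>H\<close> is close to \<open>\<rho>\<close> on a given finite set (\<open>approximate_extension\<close>). For the
  first action take \<open>H = F\<close> and \<open>\<rho> = \<alpha>\<close>: since \<open>t\<close> is not in \<open>F\<close>, the values \<open>z(1)\<close> and
  \<open>z(t)\<close> are independent of each other, so \<open>t\<close> carries some point of \<open>A\<close> out of \<open>A\<close>. For the
  second take \<open>H = F \<union> F t\<close>, a direct product of \<open>F\<close> with a group of order two, and let \<open>t\<close> act
  trivially under \<open>\<rho>\<close>.\<close>

section \<open>Coordinatewise description of the Cantor space\<close>

text \<open>Agreement in the first \<open>n\<close> coordinates replaces the metric throughout: all estimates below are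
  ultrametric, so they become statements about equality of finitely many coordinates.\<close>

definition agree :: "nat \<Rightarrow> cantor \<Rightarrow> cantor \<Rightarrow> bool" where
  "agree n x y \<longleftrightarrow> (\<forall>i<n. x i = y i)"

lemma agree_refl [simp]: "agree n x x"
  by (simp add: agree_def)

lemma agree_sym: "agree n x y \<Longrightarrow> agree n y x"
  by (simp add: agree_def)

lemma agree_trans: "agree n x y \<Longrightarrow> agree n y z \<Longrightarrow> agree n x z"
  by (simp add: agree_def)

lemma agree_mono: "agree n x y \<Longrightarrow> m \<le> n \<Longrightarrow> agree m x y"
  by (simp add: agree_def)

lemma cantor_dist_less_iff_agree: "cantor_dist x y < (1/2) ^ n \<longleftrightarrow> agree (Suc n) x y"
  by (simp add: cantor_dist_less_iff agree_def less_Suc_eq_le)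

lemma open_cantor_iff: "open U \<longleftrightarrow> (\<forall>x\<in>U. \<exists>n. \<forall>y. agree n x y \<longrightarrow> y \<in> U)"
proof -
  interpret M: Metric_space UNIV cantor_dist by (rule Metric_space_cantor)
  have "M.mtopology = euclidean"
    using mtopology_of_cantor_metric by (simp add: mtopology_of_def)
  then have "open U \<longleftrightarrow> (\<forall>x\<in>U. \<exists>r>0. M.mball x r \<subseteq> U)"
    using M.openin_mtopology[of U] by (simp add: Ball_def)
  also have "\<dots> \<longleftrightarrow> (\<forall>x\<in>U. \<exists>n. \<forall>y. agree n x y \<longrightarrow> y \<in> U)"
  proof (rule ball_cong[OF refl])
    fix x
    show "(\<exists>r>0. M.mball x r \<subseteq> U) \<longleftrightarrow> (\<exists>n. \<forall>y. agree n x y \<longrightarrow> y \<in> U)"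
    proof
      assume "\<exists>r>0. M.mball x r \<subseteq> U"
      then obtain r where r: "r > 0" "M.mball x r \<subseteq> U" by blast
      obtain n where n: "(1/2::real) ^ n < r"
        using real_arch_pow_inv[OF r(1), of "1/2"] by auto
      have "y \<in> U" if "agree (Suc n) x y" for y
        using that r(2) n cantor_dist_less_iff_agree[of x y n] by force
      then show "\<exists>n. \<forall>y. agree n x y \<longrightarrow> y \<in> U" by blast
    next
      assume "\<exists>n. \<forall>y. agree n x y \<longrightarrow> y \<in> U"
      then obtain n where n: "\<And>y. agree n x y \<Longrightarrow> y \<in> U" by blast
      have "M.mball x ((1/2) ^ n) \<subseteq> U"
        using n agree_mono[of "Suc n" x _ n] by (auto simp: cantor_dist_less_iff_agree)
      then show "\<exists>r>0. M.mball x r \<subseteq> U"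
        by (intro exI[of _ "(1/2) ^ n"]) simp
    qed
  qed
  finally show ?thesis .
qed

lemma compact_cantor: "compact (UNIV :: cantor set)"
proof -
  have "compact_space (euclidean :: bool topology)"
    by (simp add: compact_space_def finite_imp_compact)
  then have "compact_space (product_topology (\<lambda>i::nat. euclidean::bool topology) UNIV)"
    by (simp add: compact_space_product_topology)
  then show ?thesis
    by (simp add: euclidean_product_topology compact_space_def)
qed

text \<open>By compactness the modulus \<open>m\<close> can be taken independent of \<open>x\<close>, so continuity and uniform
  continuity coincide.\<close>

lemma continuous_cantor_iff:
  fixes f :: "cantor \<Rightarrow> cantor"
  shows "continuous_on UNIV f \<longleftrightarrow> (\<forall>n. \<exists>m. \<forall>x y. agree m x y \<longrightarrow> agree n (f x) (f y))"
proof
  assume f: "continuous_on UNIV f"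
  show "\<forall>n. \<exists>m. \<forall>x y. agree m x y \<longrightarrow> agree n (f x) (f y)"
  proof
    fix n
    have cyl: "open {y. agree k x y}" for k x
      by (auto simp: open_cantor_iff intro: agree_trans)
    have "\<exists>m. \<forall>y. agree m x y \<longrightarrow> agree n (f x) (f y)" for x
    proof -
      have "open (f -` {y. agree n (f x) y})"
        using f cyl by (meson continuous_on_open_vimage[OF open_UNIV] open_vimage)
      then have "\<exists>m. \<forall>y. agree m x y \<longrightarrow> y \<in> f -` {y. agree n (f x) y}"
        unfolding open_cantor_iff by (rule bspec) simp
      then show ?thesis by simp
    qed
    then obtain m where m: "\<And>x y. agree (m x) x y \<Longrightarrow> agree n (f x) (f y)"
      by metis
    have "UNIV \<subseteq> (\<Union>x. {y. agree (m x) x y})"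
      by (auto intro: agree_refl)
    then obtain D where D: "finite D" "UNIV \<subseteq> (\<Union>x\<in>D. {y. agree (m x) x y})"
      by (rule compactE_image[OF compact_cantor, rotated]) (use cyl in auto)
    define M where "M = (\<Sum>x\<in>D. m x)"
    have "agree n (f x) (f y)" if xy: "agree M x y" for x y
    proof -
      obtain u where u: "u \<in> D" "agree (m u) u x"
        using D(2) by auto
      have "m u \<le> M"
        unfolding M_def using D(1) u(1) by (simp add: member_le_sum)
      then have "agree (m u) u y"
        using u(2) xy by (meson agree_mono agree_trans)
      then show ?thesis
        using m u(2) by (meson agree_sym agree_trans)
    qed
    then show "\<exists>m. \<forall>x y. agree m x y \<longrightarrow> agree n (f x) (f y)" by blast
  qed
next
  assume *: "\<forall>n. \<exists>m. \<forall>x y. agree m x y \<longrightarrow> agree n (f x) (f y)"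
  have "open (f -` U)" if "open U" for U
    unfolding open_cantor_iff
  proof
    fix x assume "x \<in> f -` U"
    then obtain n where n: "\<And>y. agree n (f x) y \<Longrightarrow> y \<in> U"
      using \<open>open U\<close> unfolding open_cantor_iff by auto
    then show "\<exists>n. \<forall>y. agree n x y \<longrightarrow> y \<in> f -` U"
      using * by (meson vimageI)
  qed
  then show "continuous_on UNIV f"
    by (simp add: continuous_on_open_vimage)
qed

section \<open>The space of actions\<close>

text \<open>All self-maps are admitted here, not only homeomorphisms. The resulting space is complete, and
  the conditions that single out the actions define a closed subset of its power; the
  homeomorphisms alone are not closed under uniform limits.\<close>

definition cantor_map_topology :: "(cantor \<Rightarrow> cantor) topology" where
  "cantor_map_topology = mtopology_of (funspace UNIV cantor_metric)"

lemma topspace_cantor_map_topology [simp]: "topspace cantor_map_topology = UNIV"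
  unfolding cantor_map_topology_def topspace_mtopology_of by (rule mspace_funspace_cantor)

lemma openin_cantor_map_topology_iff:
  "openin cantor_map_topology V \<longleftrightarrow>
     (\<forall>f\<in>V. \<exists>n. \<forall>g. (\<forall>x. agree n (f x) (g x)) \<longrightarrow> g \<in> V)"
proof -
  define d where "d = mdist (funspace (UNIV :: cantor set) cantor_metric)"
  have M: "Metric_space UNIV d"
    unfolding d_def using Metric_space_mspace_mdist mspace_funspace_cantor by metis
  interpret M: Metric_space UNIV d by (rule M)
  have d: "d f g = (SUP x. cantor_dist (f x) (g x))" for f g
    unfolding d_def by (rule mdist_funspace_cantor)
  have bdd: "bdd_above (range (\<lambda>x. cantor_dist (f x) (g x)))" for f g :: "cantor \<Rightarrow> cantor"
    by (auto intro!: bdd_aboveI2 cantor_dist_le_1)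
  have upper: "cantor_dist (f x) (g x) \<le> d f g" for f g x
    unfolding d by (rule cSUP_upper[OF _ bdd]) simp
  have least: "d f g \<le> r" if "\<And>x. cantor_dist (f x) (g x) \<le> r" for f g r
    unfolding d by (rule cSUP_least) (use that in auto)
  have top: "cantor_map_topology = M.mtopology"
    by (simp only: cantor_map_topology_def mtopology_of_def mspace_funspace_cantor d_def)
  have "openin cantor_map_topology V \<longleftrightarrow> (\<forall>f\<in>V. \<exists>r>0. M.mball f r \<subseteq> V)"
    unfolding top M.openin_mtopology Ball_def by simp
  also have "\<dots> \<longleftrightarrow> (\<forall>f\<in>V. \<exists>n. \<forall>g. (\<forall>x. agree n (f x) (g x)) \<longrightarrow> g \<in> V)"
  proof (rule ball_cong[OF refl])
    fix f
    show "(\<exists>r>0. M.mball f r \<subseteq> V) \<longleftrightarrow> (\<exists>n. \<forall>g. (\<forall>x. agree n (f x) (g x)) \<longrightarrow> g \<in> V)"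
    proof
      assume "\<exists>r>0. M.mball f r \<subseteq> V"
      then obtain r where r: "r > 0" "M.mball f r \<subseteq> V" by blast
      obtain n where n: "(1/2::real) ^ n < r"
        using real_arch_pow_inv[OF r(1), of "1/2"] by auto
      have "g \<in> V" if "\<forall>x. agree (Suc n) (f x) (g x)" for g
      proof -
        have "d f g \<le> (1/2) ^ n"
          by (rule least) (use that cantor_dist_less_iff_agree in \<open>auto intro: less_imp_le\<close>)
        then show ?thesis using n r(2) by (auto simp: subset_iff)
      qed
      then show "\<exists>n. \<forall>g. (\<forall>x. agree n (f x) (g x)) \<longrightarrow> g \<in> V" by blast
    next
      assume "\<exists>n. \<forall>g. (\<forall>x. agree n (f x) (g x)) \<longrightarrow> g \<in> V"
      then obtain n where n: "\<And>g. (\<forall>x. agree n (f x) (g x)) \<Longrightarrow> g \<in> V" by blast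
      have "g \<in> V" if "d f g < (1/2) ^ n" for g
      proof (rule n, rule allI)
        fix x
        have "cantor_dist (f x) (g x) < (1/2) ^ n"
          using upper[of f x g] that by linarith
        then show "agree n (f x) (g x)"
          by (auto simp: cantor_dist_less_iff_agree intro: agree_mono)
      qed
      then show "\<exists>r>0. M.mball f r \<subseteq> V"
        by (intro exI[of _ "(1/2) ^ n"]) auto
    qed
  qed
  finally show ?thesis .
qed

lemma completely_metrizable_cantor_map_topology: "completely_metrizable_space cantor_map_topology"
proof -
  interpret M: Metric_space UNIV cantor_dist by (rule Metric_space_cantor)
  have "M.mtopology = euclidean"
    using mtopology_of_cantor_metric by (simp add: mtopology_of_def)
  then have "compact_space M.mtopology"
    using compact_cantor by (simp add: compact_space_def)
  then have "M.mcomplete"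
    by (rule M.compact_space_imp_mcomplete)
  then have "mcomplete_of (funspace (UNIV :: cantor set) M.Self)"
    by (rule M.mcomplete_funspace)
  then have "mcomplete_of (funspace (UNIV :: cantor set) cantor_metric)"
    by (simp only: cantor_metric_def M.Self_def)
  then show ?thesis
    unfolding cantor_map_topology_def mcomplete_of_def mtopology_of_def
    using Metric_space.completely_metrizable_space_mtopology Metric_space_mspace_mdist by blast
qed

lemma openin_product_cantor_maps_iff:
  "openin (product_topology (\<lambda>_. cantor_map_topology) I) V \<longleftrightarrow>
     V \<subseteq> extensional I \<and>
     (\<forall>\<alpha>\<in>V. \<exists>S n. finite S \<and> S \<subseteq> I \<and>
        (\<forall>\<beta>\<in>extensional I. (\<forall>s\<in>S. \<forall>x. agree n (\<alpha> s x) (\<beta> s x)) \<longrightarrow> \<beta> \<in> V))"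
  (is "?L \<longleftrightarrow> ?R")
proof
  assume L: ?L
  have "V \<subseteq> extensional I"
    using openin_subset[OF L] by (simp add: PiE_def)
  moreover have "\<exists>S n. finite S \<and> S \<subseteq> I \<and>
        (\<forall>\<beta>\<in>extensional I. (\<forall>s\<in>S. \<forall>x. agree n (\<alpha> s x) (\<beta> s x)) \<longrightarrow> \<beta> \<in> V)" if \<alpha>: "\<alpha> \<in> V" for \<alpha>
  proof -
    obtain U where U: "finite {i \<in> I. U i \<noteq> UNIV}" "\<And>i. i \<in> I \<Longrightarrow> openin cantor_map_topology (U i)"
        "\<alpha> \<in> Pi\<^sub>E I U" "Pi\<^sub>E I U \<subseteq> V"
      using L[unfolded openin_product_topology_alt, rule_format, OF \<alpha>] by auto
    define S where "S = {i \<in> I. U i \<noteq> UNIV}"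
    have "\<exists>n. \<forall>g. (\<forall>x. agree n (\<alpha> i x) (g x)) \<longrightarrow> g \<in> U i" if "i \<in> I" for i
      using U(2)[OF that] PiE_mem[OF U(3) that] unfolding openin_cantor_map_topology_iff by blast
    then obtain n where n: "\<And>i g. i \<in> I \<Longrightarrow> (\<forall>x. agree (n i) (\<alpha> i x) (g x)) \<Longrightarrow> g \<in> U i"
      by metis
    define N where "N = (\<Sum>i\<in>S. n i)"
    have N: "n i \<le> N" if "i \<in> S" for i
      unfolding N_def using U(1) that by (simp add: S_def member_le_sum)
    have "\<beta> \<in> V" if "\<beta> \<in> extensional I" "\<forall>s\<in>S. \<forall>x. agree N (\<alpha> s x) (\<beta> s x)" for \<beta>
    proof -
      have "\<beta> i \<in> U i" if "i \<in> I" for i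
      proof (cases "i \<in> S")
        case True
        then show ?thesis
          using n[OF that, of "\<beta> i"] N[OF True] \<open>\<forall>s\<in>S. _ s\<close> agree_mono by blast
      next
        case False
        then show ?thesis using that by (simp add: S_def)
      qed
      then have "\<beta> \<in> Pi\<^sub>E I U"
        using \<open>\<beta> \<in> extensional I\<close> by (simp add: PiE_iff)
      then show ?thesis using U(4) by blast
    qed
    moreover have "finite S" "S \<subseteq> I"
      using U(1) by (auto simp: S_def)
    ultimately show ?thesis by blast
  qed
  ultimately show ?R by blast
next
  assume R: ?R
  show ?L
    unfolding openin_product_topology_alt
  proof
    fix \<alpha> assume \<alpha>: "\<alpha> \<in> V"
    then obtain S n where S: "finite S" "S \<subseteq> I"
        "\<And>\<beta>. \<beta> \<in> extensional I \<Longrightarrow> (\<forall>s\<in>S. \<forall>x. agree n (\<alpha> s x) (\<beta> s x)) \<Longrightarrow> \<beta> \<in> V"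
      using R by metis
    define U where "U i = (if i \<in> S then {f. \<forall>x. agree n (\<alpha> i x) (f x)} else UNIV)" for i
    have "openin cantor_map_topology (U i)" for i
      unfolding openin_cantor_map_topology_iff U_def
      by (auto intro: agree_trans)
    moreover have "finite {i \<in> I. U i \<noteq> UNIV}"
      by (rule finite_subset[OF _ S(1)]) (auto simp: U_def)
    moreover have "\<alpha> \<in> Pi\<^sub>E I U"
      using \<alpha> R by (auto simp: U_def PiE_iff)
    moreover have "Pi\<^sub>E I U \<subseteq> V"
    proof
      fix \<beta> assume "\<beta> \<in> Pi\<^sub>E I U"
      then have "\<beta> \<in> extensional I" "\<forall>s\<in>S. \<beta> s \<in> U s"
        using S(2) by (auto simp: PiE_iff)
      then show "\<beta> \<in> V"
        using S(3)[of \<beta>] by (simp add: U_def)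
    qed
    ultimately show "\<exists>U. finite {i \<in> I. U i \<noteq> topspace cantor_map_topology} \<and>
        (\<forall>i\<in>I. openin cantor_map_topology (U i)) \<and> \<alpha> \<in> Pi\<^sub>E I U \<and> Pi\<^sub>E I U \<subseteq> V"
      by auto
  qed
qed

lemma cantor_homeos_iff:
  "f \<in> cantor_homeos \<longleftrightarrow>
     continuous_on UNIV f \<and> (\<exists>g. continuous_on UNIV g \<and> g \<circ> f = id \<and> f \<circ> g = id)"
  by (auto simp: cantor_homeos_def homeomorphic_map_maps homeomorphic_maps_def fun_eq_iff)

text \<open>Multiplicativity makes \<open>\<alpha> (inv g)\<close> a continuous inverse of \<open>\<alpha> g\<close>. Unlike bijectivity, the
  conditions on the right survive uniform limits, so in this form the actions are seen to be a
  closed set.\<close>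

lemma cantor_actions_iff:
  assumes "group G"
  shows "\<alpha> \<in> cantor_actions G \<longleftrightarrow>
    \<alpha> \<in> extensional (carrier G) \<and> (\<forall>g\<in>carrier G. continuous_on UNIV (\<alpha> g)) \<and>
    (\<forall>g\<in>carrier G. \<forall>h\<in>carrier G. \<alpha> (g \<otimes>\<^bsub>G\<^esub> h) = \<alpha> g \<circ> \<alpha> h) \<and> \<alpha> \<one>\<^bsub>G\<^esub> = id"
proof -
  interpret G: group G by fact
  show ?thesis
  proof (intro iffI conjI ballI)
    assume "\<alpha> \<in> cantor_actions G"
    then have \<alpha>: "\<alpha> \<in> hom G homeo_group" "\<alpha> \<in> extensional (carrier G)"
      by (auto simp: cantor_actions_def)
    then show "\<alpha> \<in> extensional (carrier G)" by simp
    show "continuous_on UNIV (\<alpha> g)" if "g \<in> carrier G" for g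
      using \<alpha>(1) that by (auto simp: hom_def homeo_group_def cantor_homeos_iff)
    show "\<alpha> (g \<otimes>\<^bsub>G\<^esub> h) = \<alpha> g \<circ> \<alpha> h" if "g \<in> carrier G" "h \<in> carrier G" for g h
      using \<alpha>(1) that by (auto simp: hom_def homeo_group_def)
    show "\<alpha> \<one>\<^bsub>G\<^esub> = id"
      using hom_one[OF \<alpha>(1) assms group_homeo_group] by (simp add: homeo_group_def)
  next
    assume R: "\<alpha> \<in> extensional (carrier G) \<and> (\<forall>g\<in>carrier G. continuous_on UNIV (\<alpha> g)) \<and>
      (\<forall>g\<in>carrier G. \<forall>h\<in>carrier G. \<alpha> (g \<otimes>\<^bsub>G\<^esub> h) = \<alpha> g \<circ> \<alpha> h) \<and> \<alpha> \<one>\<^bsub>G\<^esub> = id"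
    have "\<alpha> g \<in> cantor_homeos" if g: "g \<in> carrier G" for g
    proof -
      have "\<alpha> (inv\<^bsub>G\<^esub> g) \<circ> \<alpha> g = id" "\<alpha> g \<circ> \<alpha> (inv\<^bsub>G\<^esub> g) = id"
        using R g by (metis G.inv_closed G.l_inv, metis G.inv_closed G.r_inv)
      then show ?thesis
        using R g by (auto simp: cantor_homeos_iff)
    qed
    then show "\<alpha> \<in> cantor_actions G"
      using R by (auto simp: cantor_actions_def hom_def homeo_group_def)
  qed
qed

text \<open>This exhibits the space of actions as a subspace of the complete space of all families of
  self-maps, without the intermediate subspace of homeomorphisms.\<close>

lemma action_topology_eq:
  "action_topology G =
     subtopology (product_topology (\<lambda>_. cantor_map_topology) (carrier G)) (cantor_actions G)"
proof -
  have "action_topology G =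
     subtopology (product_topology (\<lambda>_. cantor_map_topology) (carrier G))
       ((\<Pi>\<^sub>E i\<in>carrier G. cantor_homeos) \<inter> cantor_actions G)"
    by (simp add: action_topology_def homeo_topology_def cantor_map_topology_def subtopology_subtopology
        flip: subtopology_product_topology)
  moreover have "(\<Pi>\<^sub>E i\<in>carrier G. cantor_homeos) \<inter> cantor_actions G = cantor_actions G"
    by (auto simp: cantor_actions_def hom_def homeo_group_def PiE_def)
  ultimately show ?thesis by simp
qed

lemma openin_action_topology_iff:
  "openin (action_topology G) V \<longleftrightarrow>
     V \<subseteq> cantor_actions G \<and>
     (\<forall>\<alpha>\<in>V. \<exists>S n. finite S \<and> S \<subseteq> carrier G \<and>
        (\<forall>\<beta>\<in>cantor_actions G. (\<forall>s\<in>S. \<forall>x. agree n (\<alpha> s x) (\<beta> s x)) \<longrightarrow> \<beta> \<in> V))"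
  (is "?L \<longleftrightarrow> ?R")
proof
  have ext: "cantor_actions G \<subseteq> extensional (carrier G)"
    by (auto simp: cantor_actions_def)
  {
    assume ?L
    then obtain T where T: "openin (product_topology (\<lambda>_. cantor_map_topology) (carrier G)) T"
        "V = T \<inter> cantor_actions G"
      by (auto simp: action_topology_eq openin_subtopology)
    show ?R
    proof (intro conjI ballI)
      show "V \<subseteq> cantor_actions G" using T(2) by blast
      fix \<alpha> assume "\<alpha> \<in> V"
      then have "\<alpha> \<in> T" using T(2) by blast
      then obtain S n where "finite S" "S \<subseteq> carrier G"
        and S: "\<forall>\<beta>\<in>extensional (carrier G). (\<forall>s\<in>S. \<forall>x. agree n (\<alpha> s x) (\<beta> s x)) \<longrightarrow> \<beta> \<in> T"
        using T(1) unfolding openin_product_cantor_maps_iff by blast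
      moreover have "\<forall>\<beta>\<in>cantor_actions G. (\<forall>s\<in>S. \<forall>x. agree n (\<alpha> s x) (\<beta> s x)) \<longrightarrow> \<beta> \<in> V"
        using S ext T(2) by blast
      ultimately show "\<exists>S n. finite S \<and> S \<subseteq> carrier G \<and>
          (\<forall>\<beta>\<in>cantor_actions G. (\<forall>s\<in>S. \<forall>x. agree n (\<alpha> s x) (\<beta> s x)) \<longrightarrow> \<beta> \<in> V)"
        by blast
    qed
  }
  assume R: ?R
  show ?L
    unfolding openin_subopen[of _ V]
  proof
    fix \<alpha> assume \<alpha>: "\<alpha> \<in> V"
    then obtain S n where S: "finite S" "S \<subseteq> carrier G"
      "\<forall>\<beta>\<in>cantor_actions G. (\<forall>s\<in>S. \<forall>x. agree n (\<alpha> s x) (\<beta> s x)) \<longrightarrow> \<beta> \<in> V"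
      using R by metis
    define T where "T = {\<beta> \<in> extensional (carrier G). \<forall>s\<in>S. \<forall>x. agree n (\<alpha> s x) (\<beta> s x)}"
    have "openin (product_topology (\<lambda>_. cantor_map_topology) (carrier G)) T"
      unfolding openin_product_cantor_maps_iff
    proof (intro conjI ballI)
      show "T \<subseteq> extensional (carrier G)" by (auto simp: T_def)
      fix \<beta> assume \<beta>: "\<beta> \<in> T"
      have "\<gamma> \<in> T" if "\<gamma> \<in> extensional (carrier G)" "\<forall>s\<in>S. \<forall>x. agree n (\<beta> s x) (\<gamma> s x)" for \<gamma>
        using \<beta> that unfolding T_def by (blast intro: agree_trans)
      then show "\<exists>S n. finite S \<and> S \<subseteq> carrier G \<and>
          (\<forall>\<gamma>\<in>extensional (carrier G). (\<forall>s\<in>S. \<forall>x. agree n (\<beta> s x) (\<gamma> s x)) \<longrightarrow> \<gamma> \<in> T)"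
        using S(1,2) by blast
    qed
    then have "openin (action_topology G) (T \<inter> cantor_actions G)"
      by (auto simp: action_topology_eq openin_subtopology)
    moreover have "\<alpha> \<in> T \<inter> cantor_actions G"
      using \<alpha> R ext by (auto simp: T_def)
    moreover have "T \<inter> cantor_actions G \<subseteq> V"
      using S(3) by (auto simp: T_def)
    ultimately show "\<exists>U. openin (action_topology G) U \<and> \<alpha> \<in> U \<and> U \<subseteq> V" by blast
  qed
qed

text \<open>A family that violates one of the conditions of \<open>cantor_actions_iff\<close> does so visibly in
  finitely many coordinates. For multiplicativity one uses that \<open>\<alpha> g\<close> is continuous, so that a
  small error in \<open>\<alpha> h x\<close> is still small after \<open>\<alpha> g\<close> is applied.\<close>

lemma closedin_cantor_actions:
  assumes "group G"
  shows "closedin (product_topology (\<lambda>_. cantor_map_topology) (carrier G)) (cantor_actions G)"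
proof -
  interpret G: group G by fact
  have ext: "cantor_actions G \<subseteq> extensional (carrier G)"
    by (auto simp: cantor_actions_def)
  have top: "topspace (product_topology (\<lambda>_. cantor_map_topology) (carrier G)) = extensional (carrier G)"
    by (simp add: PiE_def)
  have "\<exists>S n. finite S \<and> S \<subseteq> carrier G \<and>
        (\<forall>\<beta>\<in>extensional (carrier G). (\<forall>s\<in>S. \<forall>x. agree n (\<alpha> s x) (\<beta> s x)) \<longrightarrow> \<beta> \<notin> cantor_actions G)"
    if \<alpha>: "\<alpha> \<in> extensional (carrier G)" "\<alpha> \<notin> cantor_actions G" for \<alpha>
  proof -
    consider (cont) g where "g \<in> carrier G" "\<not> continuous_on UNIV (\<alpha> g)"
      | (mult) g h where "g \<in> carrier G" "h \<in> carrier G" "\<alpha> (g \<otimes>\<^bsub>G\<^esub> h) \<noteq> \<alpha> g \<circ> \<alpha> h"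
          "continuous_on UNIV (\<alpha> g)"
      | (one) "\<alpha> \<one>\<^bsub>G\<^esub> \<noteq> id"
      using \<alpha> unfolding cantor_actions_iff[OF assms] by blast
    then show ?thesis
    proof cases
      case cont
      then obtain n where n: "\<And>m. \<exists>x y. agree m x y \<and> \<not> agree n (\<alpha> g x) (\<alpha> g y)"
        unfolding continuous_cantor_iff by metis
      have "\<beta> \<notin> cantor_actions G" if "\<forall>x. agree n (\<alpha> g x) (\<beta> g x)" for \<beta>
      proof
        assume "\<beta> \<in> cantor_actions G"
        then have "continuous_on UNIV (\<beta> g)"
          using cont(1) unfolding cantor_actions_iff[OF assms] by blast
        then obtain m where m: "\<And>x y. agree m x y \<Longrightarrow> agree n (\<beta> g x) (\<beta> g y)"
          unfolding continuous_cantor_iff by metis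
        obtain x y where "agree m x y" "\<not> agree n (\<alpha> g x) (\<alpha> g y)"
          using n by blast
        then show False
          using m that by (meson agree_sym agree_trans)
      qed
      then show ?thesis
        using cont(1) by (intro exI[of _ "{g}"] exI[of _ n]) auto
    next
      case mult
      then obtain x where x: "\<alpha> (g \<otimes>\<^bsub>G\<^esub> h) x \<noteq> \<alpha> g (\<alpha> h x)" by (auto simp: fun_eq_iff)
      then obtain i where i: "\<alpha> (g \<otimes>\<^bsub>G\<^esub> h) x i \<noteq> \<alpha> g (\<alpha> h x) i" by auto
      obtain m where m: "\<And>x y. agree m x y \<Longrightarrow> agree (Suc i) (\<alpha> g x) (\<alpha> g y)"
        using mult(4) unfolding continuous_cantor_iff by metis
      have "\<beta> \<notin> cantor_actions G"
        if \<beta>: "\<forall>s\<in>{g, h, g \<otimes>\<^bsub>G\<^esub> h}. \<forall>x. agree (max m (Suc i)) (\<alpha> s x) (\<beta> s x)" for \<beta>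
      proof
        assume "\<beta> \<in> cantor_actions G"
        then have eq: "\<beta> (g \<otimes>\<^bsub>G\<^esub> h) x = \<beta> g (\<beta> h x)"
          using mult(1,2) unfolding cantor_actions_iff[OF assms] by simp
        have "agree (Suc i) (\<alpha> g (\<alpha> h x)) (\<alpha> g (\<beta> h x))"
          using \<beta> by (auto intro!: m intro: agree_mono)
        moreover have "agree (Suc i) (\<alpha> g (\<beta> h x)) (\<beta> g (\<beta> h x))"
          "agree (Suc i) (\<alpha> (g \<otimes>\<^bsub>G\<^esub> h) x) (\<beta> (g \<otimes>\<^bsub>G\<^esub> h) x)"
          using \<beta> by (auto intro: agree_mono)
        ultimately show False
          using eq i by (auto simp: agree_def)
      qed
      then show ?thesis
        using mult(1,2) by (intro exI[of _ "{g, h, g \<otimes>\<^bsub>G\<^esub> h}"] exI[of _ "max m (Suc i)"]) auto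
    next
      case one
      then obtain x i where i: "\<alpha> \<one>\<^bsub>G\<^esub> x i \<noteq> x i" by (auto simp: fun_eq_iff)
      have "\<beta> \<notin> cantor_actions G" if "\<forall>x. agree (Suc i) (\<alpha> \<one>\<^bsub>G\<^esub> x) (\<beta> \<one>\<^bsub>G\<^esub> x)" for \<beta>
        using i that[rule_format, of x] unfolding cantor_actions_iff[OF assms] by (auto simp: agree_def)
      then show ?thesis
        by (intro exI[of _ "{\<one>\<^bsub>G\<^esub>}"] exI[of _ "Suc i"]) auto
    qed
  qed
  then show ?thesis
    unfolding closedin_def top openin_product_cantor_maps_iff using ext by auto
qed

lemma completely_metrizable_action_topology:
  assumes "group G" "countable (carrier G)"
  shows "completely_metrizable_space (action_topology G)"
  unfolding action_topology_eq
proof (rule completely_metrizable_space_closedin[OF _ closedin_cantor_actions[OF assms(1)]])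
  show "completely_metrizable_space (product_topology (\<lambda>_. cantor_map_topology) (carrier G))"
    unfolding completely_metrizable_space_product_topology
    using completely_metrizable_cantor_map_topology assms(2) by auto
qed

section \<open>Coinduced actions\<close>

text \<open>Such a \<open>b\<close> identifies a \<open>T\<close>-indexed family of points of the Cantor space with a single point that
  has the same first \<open>n\<close> coordinates as the member of index \<open>t\<close>.\<close>

lemma exists_bij_prescribed_column:
  fixes T :: "'a set"
  assumes "countable T" "t \<in> T"
  shows "\<exists>b. bij_betw b (T \<times> UNIV) (UNIV :: nat set) \<and> (\<forall>i<n. b (t, i) = i)"
proof -
  define R where "R = T \<times> UNIV - {t} \<times> {..<n}"
  have "infinite (T \<times> (UNIV :: nat set))"
    using assms(2) by (auto simp: finite_cartesian_product_iff)
  then have "infinite R"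
    unfolding R_def by (simp add: Diff_infinite_finite)
  moreover have "countable R"
    unfolding R_def using assms(1) by blast
  ultimately obtain e where e: "bij_betw e R (UNIV :: nat set)"
    using countableE_infinite by blast
  have shift: "bij_betw (\<lambda>k. k + n) UNIV {n..}"
    by (rule bij_betwI[where g = "\<lambda>k. k - n"]) auto
  define b where "b p = (if p \<in> {t} \<times> {..<n} then snd p else e p + n)" for p
  have "bij_betw b ({t} \<times> {..<n}) {..<n}"
    by (rule bij_betwI[where g = "\<lambda>i. (t, i)"]) (auto simp: b_def)
  moreover have "bij_betw b R {n..}"
    using bij_betw_trans[OF e shift] by (rule bij_betw_cong[THEN iffD1, rotated]) (auto simp: b_def R_def)
  ultimately have "bij_betw b ({t} \<times> {..<n} \<union> R) ({..<n} \<union> {n..})"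
    by (rule bij_betw_combine) auto
  moreover have "{t} \<times> {..<n} \<union> R = T \<times> UNIV" "{..<n} \<union> {n..} = UNIV"
    using assms(2) by (auto simp: R_def)
  ultimately show ?thesis
    by (intro exI[of _ b]) (auto simp: b_def)
qed

text \<open>Here \<open>z x\<close> is the \<open>H\<close>-equivariant map \<open>G \<rightarrow> C\<close> that the point \<open>x\<close> encodes. The map is
  determined by its values on a transversal \<open>T\<close> of the cosets \<open>H g\<close>, and these values can be
  prescribed freely. In particular the values at \<open>\<one>\<close> and at any \<open>t\<close> outside \<open>H\<close> are
  independent.\<close>

lemma coinduced_cantor_action:
  assumes G: "group G" and cnt: "countable (carrier G)" and H: "subgroup H G"
    and cont: "\<And>h. h \<in> H \<Longrightarrow> continuous_on UNIV (\<rho> h)"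
    and mult: "\<And>h k. h \<in> H \<Longrightarrow> k \<in> H \<Longrightarrow> \<rho> (h \<otimes>\<^bsub>G\<^esub> k) = \<rho> h \<circ> \<rho> k"
    and one: "\<rho> \<one>\<^bsub>G\<^esub> = id"
  obtains \<beta> z where "\<beta> \<in> cantor_actions G"
    "\<And>h g x. h \<in> H \<Longrightarrow> g \<in> carrier G \<Longrightarrow> z x (h \<otimes>\<^bsub>G\<^esub> g) = \<rho> h (z x g)"
    "\<And>s g x. s \<in> carrier G \<Longrightarrow> g \<in> carrier G \<Longrightarrow> z (\<beta> s x) g = z x (g \<otimes>\<^bsub>G\<^esub> s)"
    "\<And>x. agree n (z x \<one>\<^bsub>G\<^esub>) x"
    "\<And>t u v. t \<in> carrier G - H \<Longrightarrow> \<exists>x. z x \<one>\<^bsub>G\<^esub> = u \<and> z x t = v"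
proof -
  interpret G: group G by (rule G)
  interpret H: subgroup H G by (rule H)
  \<comment> \<open>Every \<open>g\<close> factors as \<open>\<kappa> g \<otimes> \<tau> g\<close> with \<open>\<kappa> g\<close> in \<open>H\<close> and \<open>\<tau> g\<close> the chosen representative
    of \<open>H g\<close>; the coset \<open>H\<close> itself must be represented by \<open>\<one>\<close>, where \<open>x\<close> and \<open>z x\<close> are compared.\<close>
  define \<tau> where "\<tau> g = (if H #>\<^bsub>G\<^esub> g = H then \<one>\<^bsub>G\<^esub> else SOME x. x \<in> H #>\<^bsub>G\<^esub> g)" for g
  define \<kappa> where "\<kappa> g = g \<otimes>\<^bsub>G\<^esub> inv\<^bsub>G\<^esub> (\<tau> g)" for g
  have \<tau>_coset: "\<tau> g \<in> H #>\<^bsub>G\<^esub> g" if "g \<in> carrier G" for g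
    using G.rcos_self[OF that H] by (auto simp: \<tau>_def intro: someI)
  have coset_sub: "H #>\<^bsub>G\<^esub> g \<subseteq> carrier G" if "g \<in> carrier G" for g
    using that by (simp add: G.r_coset_subset_G H.subset)
  have \<tau>_carrier [simp]: "\<tau> g \<in> carrier G" if "g \<in> carrier G" for g
    using \<tau>_coset coset_sub that by blast
  have \<tau>_cong: "\<tau> g = \<tau> g'" if "g' \<in> H #>\<^bsub>G\<^esub> g" "g \<in> carrier G" for g g'
    using G.repr_independence[OF that H] by (simp add: \<tau>_def)
  have \<tau>_mult: "\<tau> (h \<otimes>\<^bsub>G\<^esub> g) = \<tau> g" if "h \<in> H" "g \<in> carrier G" for h g
    using that by (intro \<tau>_cong[symmetric]) (auto simp: r_coset_def)
  have \<tau>_idem: "\<tau> (\<tau> g) = \<tau> g" if "g \<in> carrier G" for g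
    using \<tau>_cong[OF \<tau>_coset[OF that] that] by simp
  have \<tau>_H: "\<tau> h = \<one>\<^bsub>G\<^esub>" if "h \<in> H" for h
    using that G.coset_join2[OF _ H that] by (simp add: \<tau>_def)
  have \<kappa>_H: "\<kappa> g \<in> H" if g: "g \<in> carrier G" for g
  proof -
    obtain h where h: "h \<in> H" "\<tau> g = h \<otimes>\<^bsub>G\<^esub> g"
      using \<tau>_coset[OF g] by (auto simp: r_coset_def)
    then have "\<kappa> g = inv\<^bsub>G\<^esub> h"
      using g by (simp add: \<kappa>_def G.inv_mult_group G.m_assoc[symmetric])
    then show ?thesis using h(1) by simp
  qed
  have \<kappa>_\<tau>: "\<kappa> g \<otimes>\<^bsub>G\<^esub> \<tau> g = g" if "g \<in> carrier G" for g
    using that by (simp add: \<kappa>_def G.m_assoc)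
  have \<kappa>_mult: "\<kappa> (h \<otimes>\<^bsub>G\<^esub> g) = h \<otimes>\<^bsub>G\<^esub> \<kappa> g" if "h \<in> H" "g \<in> carrier G" for h g
    using that by (simp add: \<kappa>_def \<tau>_mult G.m_assoc)
  have \<kappa>_rep: "\<kappa> (\<tau> g) = \<one>\<^bsub>G\<^esub>" if "g \<in> carrier G" for g
    using that by (simp add: \<kappa>_def \<tau>_idem)
  define T where "T = \<tau> ` carrier G"
  have T1: "\<one>\<^bsub>G\<^esub> \<in> T"
    unfolding T_def using \<tau>_H[OF H.one_closed] by (metis G.one_closed image_eqI)
  have T_carrier: "t \<in> carrier G" if "t \<in> T" for t
    using that by (auto simp: T_def)
  have \<tau>_T: "\<tau> t = t" "\<kappa> t = \<one>\<^bsub>G\<^esub>" if "t \<in> T" for t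
    using that by (auto simp: T_def \<tau>_idem \<kappa>_rep)
  obtain b where b: "bij_betw b (T \<times> UNIV) (UNIV :: nat set)" "\<And>i. i < n \<Longrightarrow> b (\<one>\<^bsub>G\<^esub>, i) = i"
    using exists_bij_prescribed_column[OF _ T1] cnt unfolding T_def by (metis countable_image)
  define c where "c = inv_into (T \<times> UNIV) b"
  have cb: "c (b (t, i)) = (t, i)" if "t \<in> T" for t i
    unfolding c_def using b(1) that by (intro inv_into_f_f) (auto simp: bij_betw_def)
  have bc: "b (c j) = j" and c_T: "fst (c j) \<in> T" for j
  proof -
    have j: "j \<in> b ` (T \<times> UNIV)" using b(1) by (auto simp: bij_betw_def)
    show "b (c j) = j" unfolding c_def by (rule f_inv_into_f[OF j])
    show "fst (c j) \<in> T" using inv_into_into[OF j] unfolding c_def by (auto simp: mem_Times_iff)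
  qed
  \<comment> \<open>\<open>w x\<close> is the family indexed by \<open>T\<close> that \<open>x\<close> encodes, and \<open>unw\<close> encodes a family.\<close>
  define w :: "cantor \<Rightarrow> 'a \<Rightarrow> cantor" where "w x t = (\<lambda>i. x (b (t, i)))" for x t
  define unw :: "('a \<Rightarrow> cantor) \<Rightarrow> cantor" where "unw W = (\<lambda>j. W (fst (c j)) (snd (c j)))" for W
  have w_unw: "w (unw W) t = W t" if "t \<in> T" for W t
    using that by (simp add: w_def unw_def cb)
  have unw_w: "unw (w x) = x" for x
    by (simp add: w_def unw_def bc)
  define z where "z x g = \<rho> (\<kappa> g) (w x (\<tau> g))" for x g
  have z_H: "z x (h \<otimes>\<^bsub>G\<^esub> g) = \<rho> h (z x g)" if "h \<in> H" "g \<in> carrier G" for h g x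
    using that by (simp add: z_def \<kappa>_mult \<tau>_mult mult \<kappa>_H)
  have z_T: "z x t = w x t" if "t \<in> T" for x t
    using that by (simp add: z_def \<tau>_T one)
  have z_inject: "x = y" if eq: "\<And>g. g \<in> carrier G \<Longrightarrow> z x g = z y g" for x y
  proof -
    have "w x t = w y t" if "t \<in> T" for t
      using eq[OF T_carrier[OF that]] that by (simp add: z_T)
    then have "unw (w x) = unw (w y)"
      by (simp add: unw_def c_T)
    then show ?thesis by (simp add: unw_w)
  qed
  define \<beta> where "\<beta> = (\<lambda>s\<in>carrier G. \<lambda>x. unw (\<lambda>t. z x (t \<otimes>\<^bsub>G\<^esub> s)))"
  have z_\<beta>: "z (\<beta> s x) g = z x (g \<otimes>\<^bsub>G\<^esub> s)" if s: "s \<in> carrier G" and g: "g \<in> carrier G" for s g x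
  proof -
    have "w (\<beta> s x) (\<tau> g) = z x (\<tau> g \<otimes>\<^bsub>G\<^esub> s)"
      using s g by (simp add: \<beta>_def w_unw T_def)
    then have "z (\<beta> s x) g = \<rho> (\<kappa> g) (z x (\<tau> g \<otimes>\<^bsub>G\<^esub> s))"
      by (simp add: z_def[of "\<beta> s x" g])
    also have "\<dots> = z x (\<kappa> g \<otimes>\<^bsub>G\<^esub> (\<tau> g \<otimes>\<^bsub>G\<^esub> s))"
      using s g by (intro z_H[symmetric]) (auto simp: \<kappa>_H)
    also have "\<kappa> g \<otimes>\<^bsub>G\<^esub> (\<tau> g \<otimes>\<^bsub>G\<^esub> s) = g \<otimes>\<^bsub>G\<^esub> s"
      using s g \<kappa>_H[OF g] by (simp add: G.m_assoc[symmetric] \<kappa>_\<tau> H.mem_carrier)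
    finally show ?thesis .
  qed
  have "\<beta> \<in> cantor_actions G"
    unfolding cantor_actions_iff[OF G]
  proof (intro conjI ballI)
    show "\<beta> \<in> extensional (carrier G)" by (simp add: \<beta>_def)
    fix s assume s: "s \<in> carrier G"
    show "continuous_on UNIV (\<beta> s)"
    proof (rule continuous_on_coordinatewise_then_product)
      fix j
      define g where "g = fst (c j) \<otimes>\<^bsub>G\<^esub> s"
      have g: "g \<in> carrier G"
        using s c_T T_carrier by (simp add: g_def)
      have "continuous_on UNIV (\<lambda>x. w x (\<tau> g))"
        unfolding w_def by (intro continuous_on_coordinatewise_then_product continuous_on_product_coordinates)
      then have "continuous_on UNIV (\<lambda>x. \<rho> (\<kappa> g) (w x (\<tau> g)))"
        by (rule continuous_on_compose2[OF cont[OF \<kappa>_H[OF g]]]) simp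
      then have "continuous_on UNIV (\<lambda>x. \<rho> (\<kappa> g) (w x (\<tau> g)) (snd (c j)))"
        by (rule continuous_on_product_then_coordinatewise)
      then show "continuous_on UNIV (\<lambda>x. \<beta> s x j)"
        using s by (simp add: \<beta>_def unw_def z_def g_def)
    qed
    show "\<beta> (s \<otimes>\<^bsub>G\<^esub> s') = \<beta> s \<circ> \<beta> s'" if s': "s' \<in> carrier G" for s'
    proof
      fix x
      show "\<beta> (s \<otimes>\<^bsub>G\<^esub> s') x = (\<beta> s \<circ> \<beta> s') x"
        by (rule z_inject) (use s s' in \<open>simp add: z_\<beta> G.m_assoc\<close>)
    qed
  next
    show "\<beta> \<one>\<^bsub>G\<^esub> = id"
    proof
      fix x
      show "\<beta> \<one>\<^bsub>G\<^esub> x = id x"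
        by (rule z_inject) (simp add: z_\<beta>)
    qed
  qed
  moreover have "agree n (z x \<one>\<^bsub>G\<^esub>) x" for x
    using z_T[OF T1] b(2) by (simp add: agree_def w_def)
  moreover have "\<exists>x. z x \<one>\<^bsub>G\<^esub> = u \<and> z x t = v" if t: "t \<in> carrier G - H" for t u v
  proof -
    have "\<tau> t \<noteq> \<one>\<^bsub>G\<^esub>"
      using \<kappa>_\<tau>[of t] \<kappa>_H[of t] t H.mem_carrier by fastforce
    define x where "x = unw ((\<lambda>_. u)(\<tau> t := \<rho> (inv\<^bsub>G\<^esub> (\<kappa> t)) v))"
    have "z x \<one>\<^bsub>G\<^esub> = u"
      using \<open>\<tau> t \<noteq> \<one>\<^bsub>G\<^esub>\<close> by (simp add: z_T[OF T1] x_def w_unw[OF T1])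
    moreover have "z x t = v"
    proof -
      have "z x t = (\<rho> (\<kappa> t) \<circ> \<rho> (inv\<^bsub>G\<^esub> (\<kappa> t))) v"
        using t w_unw[of "\<tau> t"] by (simp add: z_def x_def T_def)
      also have "\<rho> (\<kappa> t) \<circ> \<rho> (inv\<^bsub>G\<^esub> (\<kappa> t)) = id"
        using t \<kappa>_H[of t] mult[of "\<kappa> t" "inv\<^bsub>G\<^esub> (\<kappa> t)"] by (simp add: H.mem_carrier one)
      finally show ?thesis by simp
    qed
    ultimately show ?thesis by blast
  qed
  ultimately show thesis
    using z_H z_\<beta> that[of \<beta> z] by blast
qed

section \<open>Centralizing involutions in the Hall group\<close>

text \<open>The direct product of \<open>F\<close> with a group of order two embeds into \<open>G\<close>. The image \<open>K\<close> of the factor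
  \<open>F\<close> is isomorphic to \<open>F\<close>, hence conjugate to it, and the same conjugation carries the image \<open>s\<close> of
  the other generator to the required element. It is enough that the conjugation maps \<open>K\<close> onto
  \<open>F\<close> as a set, whatever isomorphism it induces.\<close>

lemma hall_exists_centralizing_involution:
  assumes hall: "hall_universal_group G" and F: "subgroup F G" "finite F"
  obtains t where "t \<in> carrier G" "t \<notin> F" "t \<otimes>\<^bsub>G\<^esub> t = \<one>\<^bsub>G\<^esub>"
    "\<And>f. f \<in> F \<Longrightarrow> t \<otimes>\<^bsub>G\<^esub> f = f \<otimes>\<^bsub>G\<^esub> t"
proof -
  have G: "group G"
    using hall by (simp add: hall_universal_group_def locally_finite_group_def)
  interpret G: group G by (rule G)
  let ?F = "G\<lparr>carrier := F\<rparr>" and ?Z = "integer_mod_group 2"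
  have Z: "carrier ?Z = {0, 1}"
    by (auto simp: carrier_integer_mod_group)
  have grpF: "group ?F" by (rule G.subgroup_imp_group[OF F(1)])
  have "group (?F \<times>\<times> ?Z)"
    by (rule DirProd_group[OF grpF group_integer_mod_group])
  moreover have "finite (carrier (?F \<times>\<times> ?Z))"
    using F(2) Z by simp
  ultimately obtain L where L: "subgroup L G" "?F \<times>\<times> ?Z \<cong> G\<lparr>carrier := L\<rparr>"
    using hall_universal_group_contains_finite[OF hall] by blast
  then obtain \<psi> where \<psi>: "\<psi> \<in> iso (?F \<times>\<times> ?Z) (G\<lparr>carrier := L\<rparr>)"
    by (auto simp: is_iso_def)
  have inj: "inj_on \<psi> (F \<times> {0, 1})" and img: "\<psi> p \<in> carrier G" if "p \<in> F \<times> {0, 1}" for p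
    using \<psi> that Z subgroup.subset[OF L(1)] by (auto simp: iso_def bij_betw_def DirProd_def)
  have mult: "\<psi> (f \<otimes>\<^bsub>G\<^esub> f', (i + j) mod 2) = \<psi> (f, i) \<otimes>\<^bsub>G\<^esub> \<psi> (f', j)"
    if "f \<in> F" "f' \<in> F" "i \<in> {0, 1}" "j \<in> {0, 1}" for f f' i j
    using \<psi> that Z by (auto simp: iso_def hom_def DirProd_def)
  have F1: "\<one>\<^bsub>G\<^esub> \<in> F" by (rule subgroup.one_closed[OF F(1)])
  define \<iota> where "\<iota> f = \<psi> (f, 0)" for f
  define K where "K = \<iota> ` F"
  have "\<iota> \<in> hom ?F G"
    using img mult[of _ _ 0 0] by (auto simp: hom_def \<iota>_def)
  then interpret \<iota>: group_hom ?F G \<iota>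
    using grpF G by (simp add: group_hom_def group_hom_axioms_def)
  have K: "subgroup K G"
    using \<iota>.img_is_subgroup by (simp add: K_def)
  have fg: "finitely_generated_subgroup S G" if "subgroup S G" "finite S" for S
    unfolding finitely_generated_subgroup_def
    using that G.generate_subgroup_incl[OF _ that(1), of S] generate.incl[of _ S G] subgroup.subset[OF that(1)]
    by (intro exI[of _ S]) auto
  have "\<iota> \<in> iso ?F (G\<lparr>carrier := K\<rparr>)"
    using inj \<iota>.homh F1 by (auto simp: iso_def hom_def K_def bij_betw_def inj_on_def \<iota>_def)
  then have "?F \<cong> G\<lparr>carrier := K\<rparr>"
    by (auto simp: is_iso_def)
  moreover have "finite K" using F(2) by (simp add: K_def)
  ultimately have "conjugate_subgroups G F K"
    using hall fg F K unfolding hall_universal_group_def by blast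
  then obtain g where g: "g \<in> carrier G" "K = (\<lambda>f. g \<otimes>\<^bsub>G\<^esub> f \<otimes>\<^bsub>G\<^esub> inv\<^bsub>G\<^esub> g) ` F"
    by (auto simp: conjugate_subgroups_def)
  define s where "s = \<psi> (\<one>\<^bsub>G\<^esub>, 1)"
  have s: "s \<in> carrier G" using img[of "(\<one>\<^bsub>G\<^esub>, 1)"] F1 by (simp add: s_def)
  have ss: "s \<otimes>\<^bsub>G\<^esub> s = \<one>\<^bsub>G\<^esub>"
    using mult[of "\<one>\<^bsub>G\<^esub>" "\<one>\<^bsub>G\<^esub>" 1 1] F1 \<iota>.hom_one by (simp add: s_def \<iota>_def)
  have sk: "s \<otimes>\<^bsub>G\<^esub> k = k \<otimes>\<^bsub>G\<^esub> s" if k: "k \<in> K" for k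
  proof -
    obtain f where f: "f \<in> F" "k = \<psi> (f, 0)" using k by (auto simp: K_def \<iota>_def)
    then show ?thesis
      using mult[of "\<one>\<^bsub>G\<^esub>" f 1 0] mult[of f "\<one>\<^bsub>G\<^esub>" 0 1] F1 subgroup.mem_carrier[OF F(1) f(1)]
      by (simp add: s_def)
  qed
  have sK: "s \<notin> K"
    using inj[unfolded inj_on_def] F1 by (fastforce simp: s_def K_def \<iota>_def)
  define t where "t = inv\<^bsub>G\<^esub> g \<otimes>\<^bsub>G\<^esub> s \<otimes>\<^bsub>G\<^esub> g"
  have t: "t \<in> carrier G" using g(1) s by (simp add: t_def)
  have gt: "g \<otimes>\<^bsub>G\<^esub> t \<otimes>\<^bsub>G\<^esub> inv\<^bsub>G\<^esub> g = s"
    using g(1) s by (simp add: t_def G.m_assoc[symmetric]) (simp add: G.m_assoc)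
  have conj_mult: "g \<otimes>\<^bsub>G\<^esub> (a \<otimes>\<^bsub>G\<^esub> b) \<otimes>\<^bsub>G\<^esub> inv\<^bsub>G\<^esub> g =
      (g \<otimes>\<^bsub>G\<^esub> a \<otimes>\<^bsub>G\<^esub> inv\<^bsub>G\<^esub> g) \<otimes>\<^bsub>G\<^esub> (g \<otimes>\<^bsub>G\<^esub> b \<otimes>\<^bsub>G\<^esub> inv\<^bsub>G\<^esub> g)"
    if "a \<in> carrier G" "b \<in> carrier G" for a b
    using that g(1) by (simp add: G.m_assoc G.inv_solve_left)
  have conj_inj: "a = b" if "a \<in> carrier G" "b \<in> carrier G"
      "g \<otimes>\<^bsub>G\<^esub> a \<otimes>\<^bsub>G\<^esub> inv\<^bsub>G\<^esub> g = g \<otimes>\<^bsub>G\<^esub> b \<otimes>\<^bsub>G\<^esub> inv\<^bsub>G\<^esub> g" for a b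
    using that g(1) by simp
  show thesis
  proof (rule that)
    show "t \<in> carrier G" by (rule t)
    show "t \<notin> F" using sK gt g(2) by blast
    show "t \<otimes>\<^bsub>G\<^esub> t = \<one>\<^bsub>G\<^esub>"
      by (rule conj_inj) (use t g(1) ss in \<open>simp_all add: conj_mult gt\<close>)
    fix f assume f: "f \<in> F"
    then have fc: "f \<in> carrier G" by (rule subgroup.mem_carrier[OF F(1)])
    show "t \<otimes>\<^bsub>G\<^esub> f = f \<otimes>\<^bsub>G\<^esub> t"
      by (rule conj_inj) (use t fc f g(2) sk in \<open>simp_all add: conj_mult gt\<close>)
  qed
qed

section \<open>Perturbing actions\<close>

text \<open>Let \<open>z\<close> be the equivariant map encoded by \<open>x\<close> in the coinduced action \<open>\<beta>\<close>. Points agree to high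
  order with the value at \<open>\<one>\<close> of the map that they encode, and \<open>\<beta> f x\<close> encodes a map with value
  \<open>\<rho> f (z \<one>)\<close> at \<open>\<one>\<close>. Continuity of \<open>\<rho> f\<close> then bounds the error between \<open>\<beta> f x\<close> and \<open>\<rho> f x\<close>.\<close>

lemma approximate_extension:
  assumes G: "group G" "countable (carrier G)" and H: "subgroup H G"
    and cont: "\<And>h. h \<in> H \<Longrightarrow> continuous_on UNIV (\<rho> h)"
    and mult: "\<And>h k. h \<in> H \<Longrightarrow> k \<in> H \<Longrightarrow> \<rho> (h \<otimes>\<^bsub>G\<^esub> k) = \<rho> h \<circ> \<rho> k"
    and one: "\<rho> \<one>\<^bsub>G\<^esub> = id"
    and F: "finite F" "F \<subseteq> H"
  shows "\<exists>\<beta>\<in>cantor_actions G. (\<forall>f\<in>F. \<forall>x. agree n (\<rho> f x) (\<beta> f x)) \<and>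
    (\<forall>t\<in>carrier G - H. \<forall>u v. \<exists>x. agree n u x \<and> agree n v (\<beta> t x))"
proof -
  interpret G: group G by (rule G)
  have "\<exists>m. \<forall>x y. agree m x y \<longrightarrow> agree n (\<rho> f x) (\<rho> f y)" if "f \<in> F" for f
    using cont[of f] that F(2) unfolding continuous_cantor_iff by blast
  then obtain m where m: "\<And>f x y. f \<in> F \<Longrightarrow> agree (m f) x y \<Longrightarrow> agree n (\<rho> f x) (\<rho> f y)"
    by metis
  define M where "M = n + (\<Sum>f\<in>F. m f)"
  have mM: "m f \<le> M" if "f \<in> F" for f
    unfolding M_def using F(1) that by (simp add: member_le_sum trans_le_add2)
  have nM: "n \<le> M" by (simp add: M_def)
  obtain \<beta> z where \<beta>: "\<beta> \<in> cantor_actions G"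
    and zH: "\<And>h g x. h \<in> H \<Longrightarrow> g \<in> carrier G \<Longrightarrow> z x (h \<otimes>\<^bsub>G\<^esub> g) = \<rho> h (z x g)"
    and z\<beta>: "\<And>s g x. s \<in> carrier G \<Longrightarrow> g \<in> carrier G \<Longrightarrow> z (\<beta> s x) g = z x (g \<otimes>\<^bsub>G\<^esub> s)"
    and z1: "\<And>x. agree M (z x \<one>\<^bsub>G\<^esub>) x"
    and zt: "\<And>t u v. t \<in> carrier G - H \<Longrightarrow> \<exists>x. z x \<one>\<^bsub>G\<^esub> = u \<and> z x t = v"
    using coinduced_cantor_action[where \<rho> = \<rho> and n = M, OF G H cont mult one] by blast
  have \<beta>_agree: "agree M (z x t) (\<beta> t x)" if "t \<in> carrier G" for t x
    using z1[of "\<beta> t x"] z\<beta>[OF that, of "\<one>\<^bsub>G\<^esub>" x] that by simp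
  show ?thesis
  proof (intro bexI[OF _ \<beta>] conjI ballI allI)
    fix f x assume f: "f \<in> F"
    then have fG: "f \<in> carrier G" and fH: "f \<in> H"
      using F(2) subgroup.subset[OF H] by auto
    have "agree n (\<rho> f (z x \<one>\<^bsub>G\<^esub>)) (\<rho> f x)"
      using z1 mM[OF f] by (blast intro: m[OF f] agree_mono)
    moreover have "agree n (\<rho> f (z x \<one>\<^bsub>G\<^esub>)) (\<beta> f x)"
      using \<beta>_agree[OF fG, of x] zH[OF fH, of "\<one>\<^bsub>G\<^esub>" x] fG nM by (auto intro: agree_mono)
    ultimately show "agree n (\<rho> f x) (\<beta> f x)"
      by (blast intro: agree_sym agree_trans)
  next
    fix t u v assume t: "t \<in> carrier G - H"
    then obtain x where x: "z x \<one>\<^bsub>G\<^esub> = u" "z x t = v"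
      using zt by blast
    have "agree n u x" "agree n v (\<beta> t x)"
      using z1[of x] \<beta>_agree[of t x] t x nM by (auto intro: agree_mono)
    then show "\<exists>x. agree n u x \<and> agree n v (\<beta> t x)" by blast
  qed
qed

text \<open>The element \<open>t\<close> is invisible to the values of an action on \<open>S\<close>: in one approximation of \<open>\<alpha>\<close> it
  joins any two cylinders of length \<open>n\<close>, in another one it is close to the identity.\<close>

lemma hall_perturb_action:
  assumes hall: "hall_universal_group G" and \<alpha>: "\<alpha> \<in> cantor_actions G"
    and S: "finite S" "S \<subseteq> carrier G"
  obtains t \<beta> \<gamma> where "t \<in> carrier G" "\<beta> \<in> cantor_actions G" "\<gamma> \<in> cantor_actions G"
    "\<And>s x. s \<in> S \<Longrightarrow> agree n (\<alpha> s x) (\<beta> s x)" "\<And>s x. s \<in> S \<Longrightarrow> agree n (\<alpha> s x) (\<gamma> s x)"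
    "\<And>u v. \<exists>x. agree n u x \<and> agree n v (\<beta> t x)" "\<And>x. agree n x (\<gamma> t x)"
proof -
  have G: "group G" and cnt: "countable (carrier G)"
    using hall by (auto simp: hall_universal_group_def locally_finite_group_def)
  interpret G: group G by (rule G)
  define F where "F = generate G S"
  have F: "subgroup F G"
    unfolding F_def using S(2) by (rule G.generate_is_subgroup)
  have finF: "finite F"
    using hall S unfolding hall_universal_group_def locally_finite_group_def
      finitely_generated_subgroup_def F_def by blast
  have SF: "S \<subseteq> F"
    unfolding F_def by (auto intro: generate.incl)
  interpret F: subgroup F G by (rule F)
  have \<alpha>_cont: "continuous_on UNIV (\<alpha> g)" if "g \<in> carrier G" for g
    using \<alpha> that unfolding cantor_actions_iff[OF G] by blast
  have \<alpha>_mult: "\<alpha> (g \<otimes>\<^bsub>G\<^esub> h) = \<alpha> g \<circ> \<alpha> h" if "g \<in> carrier G" "h \<in> carrier G" for g h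
    using \<alpha> that unfolding cantor_actions_iff[OF G] by blast
  have \<alpha>_one: "\<alpha> \<one>\<^bsub>G\<^esub> = id"
    using \<alpha> unfolding cantor_actions_iff[OF G] by blast
  obtain t where t: "t \<in> carrier G" "t \<notin> F" "t \<otimes>\<^bsub>G\<^esub> t = \<one>\<^bsub>G\<^esub>"
    and tF: "\<And>f. f \<in> F \<Longrightarrow> t \<otimes>\<^bsub>G\<^esub> f = f \<otimes>\<^bsub>G\<^esub> t"
    using hall_exists_centralizing_involution[OF hall F finF] by blast
  have \<alpha>F_cont: "continuous_on UNIV (\<alpha> h)" if "h \<in> F" for h
    using that by (intro \<alpha>_cont F.mem_carrier)
  have \<alpha>F_mult: "\<alpha> (h \<otimes>\<^bsub>G\<^esub> k) = \<alpha> h \<circ> \<alpha> k" if "h \<in> F" "k \<in> F" for h k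
    using that by (intro \<alpha>_mult F.mem_carrier)
  obtain \<beta> where \<beta>: "\<beta> \<in> cantor_actions G" "\<forall>s\<in>S. \<forall>x. agree n (\<alpha> s x) (\<beta> s x)"
      "\<forall>t\<in>carrier G - F. \<forall>u v. \<exists>x. agree n u x \<and> agree n v (\<beta> t x)"
    using approximate_extension[where \<rho> = \<alpha> and n = n,
        OF G cnt F \<alpha>F_cont \<alpha>F_mult \<alpha>_one S(1) SF] by blast
  \<comment> \<open>\<open>H\<close> is the internal direct product of \<open>F\<close> and \<open>{\<one>, t}\<close>, and \<open>\<rho>\<close> below is the action
    \<open>\<alpha>\<close> of \<open>F\<close> composed with the projection of \<open>H\<close> onto \<open>F\<close>.\<close>
  define H where "H = F \<union> (\<lambda>f. f \<otimes>\<^bsub>G\<^esub> t) ` F"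
  have ft_notin: "f \<otimes>\<^bsub>G\<^esub> t \<notin> F" if "f \<in> F" for f
  proof
    assume "f \<otimes>\<^bsub>G\<^esub> t \<in> F"
    then have "inv\<^bsub>G\<^esub> f \<otimes>\<^bsub>G\<^esub> (f \<otimes>\<^bsub>G\<^esub> t) \<in> F"
      using that by simp
    then show False
      using t(1,2) that by (simp add: G.m_assoc[symmetric] F.mem_carrier)
  qed
  have FFt: "f \<otimes>\<^bsub>G\<^esub> (f' \<otimes>\<^bsub>G\<^esub> t) = (f \<otimes>\<^bsub>G\<^esub> f') \<otimes>\<^bsub>G\<^esub> t"
    and FtF: "(f \<otimes>\<^bsub>G\<^esub> t) \<otimes>\<^bsub>G\<^esub> f' = (f \<otimes>\<^bsub>G\<^esub> f') \<otimes>\<^bsub>G\<^esub> t"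
    and FtFt: "(f \<otimes>\<^bsub>G\<^esub> t) \<otimes>\<^bsub>G\<^esub> (f' \<otimes>\<^bsub>G\<^esub> t) = f \<otimes>\<^bsub>G\<^esub> f'"
    if "f \<in> F" "f' \<in> F" for f f'
  proof -
    note c = F.mem_carrier[OF that(1)] F.mem_carrier[OF that(2)] t(1)
    show "f \<otimes>\<^bsub>G\<^esub> (f' \<otimes>\<^bsub>G\<^esub> t) = (f \<otimes>\<^bsub>G\<^esub> f') \<otimes>\<^bsub>G\<^esub> t"
      using c by (simp add: G.m_assoc)
    show *: "(f \<otimes>\<^bsub>G\<^esub> t) \<otimes>\<^bsub>G\<^esub> f' = (f \<otimes>\<^bsub>G\<^esub> f') \<otimes>\<^bsub>G\<^esub> t"
      using c tF[OF that(2)] by (simp add: G.m_assoc)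
    have "(f \<otimes>\<^bsub>G\<^esub> t) \<otimes>\<^bsub>G\<^esub> (f' \<otimes>\<^bsub>G\<^esub> t) = ((f \<otimes>\<^bsub>G\<^esub> t) \<otimes>\<^bsub>G\<^esub> f') \<otimes>\<^bsub>G\<^esub> t"
      using c by (simp add: G.m_assoc)
    also have "\<dots> = f \<otimes>\<^bsub>G\<^esub> f'"
      unfolding * using c t(3) by (simp add: G.m_assoc)
    finally show "(f \<otimes>\<^bsub>G\<^esub> t) \<otimes>\<^bsub>G\<^esub> (f' \<otimes>\<^bsub>G\<^esub> t) = f \<otimes>\<^bsub>G\<^esub> f'" .
  qed
  have tH: "t = \<one>\<^bsub>G\<^esub> \<otimes>\<^bsub>G\<^esub> t" using t(1) by simp
  have H: "subgroup H G"
  proof (rule G.subgroupI)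
    show "H \<subseteq> carrier G" using t(1) F.subset by (auto simp: H_def)
    show "H \<noteq> {}" using F.one_closed unfolding H_def by blast
    show "a \<otimes>\<^bsub>G\<^esub> b \<in> H" if "a \<in> H" "b \<in> H" for a b
      using that unfolding H_def by (auto simp: FFt FtF FtFt)
    show "inv\<^bsub>G\<^esub> a \<in> H" if "a \<in> H" for a
    proof (cases "a \<in> F")
      case False
      then obtain f where f: "f \<in> F" "a = f \<otimes>\<^bsub>G\<^esub> t"
        using \<open>a \<in> H\<close> by (auto simp: H_def)
      have "(inv\<^bsub>G\<^esub> f \<otimes>\<^bsub>G\<^esub> t) \<otimes>\<^bsub>G\<^esub> a = \<one>\<^bsub>G\<^esub>"
        using FtFt[of "inv\<^bsub>G\<^esub> f" f] f F.mem_carrier[OF f(1)] by simp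
      then have "inv\<^bsub>G\<^esub> a = inv\<^bsub>G\<^esub> f \<otimes>\<^bsub>G\<^esub> t"
        using f t(1) F.mem_carrier[OF f(1)] by (intro G.inv_equality) auto
      then show ?thesis using f(1) by (auto simp: H_def)
    qed (auto simp: H_def)
  qed
  define \<rho> where "\<rho> h = (if h \<in> F then \<alpha> h else \<alpha> (h \<otimes>\<^bsub>G\<^esub> t))" for h
  have \<rho>_F: "\<rho> f = \<alpha> f" if "f \<in> F" for f
    using that by (simp add: \<rho>_def)
  have \<rho>_Ft: "\<rho> (f \<otimes>\<^bsub>G\<^esub> t) = \<alpha> f" if "f \<in> F" for f
    using ft_notin[OF that] F.mem_carrier[OF that] t by (simp add: \<rho>_def G.m_assoc)
  have \<rho>_cont: "continuous_on UNIV (\<rho> h)" if "h \<in> H" for h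
    using that \<alpha>_cont F.mem_carrier by (auto simp: H_def \<rho>_F \<rho>_Ft)
  have \<rho>_mult: "\<rho> (h \<otimes>\<^bsub>G\<^esub> k) = \<rho> h \<circ> \<rho> k" if "h \<in> H" "k \<in> H" for h k
    using that F.mem_carrier unfolding H_def
    by (auto simp: FFt FtF FtFt \<rho>_F \<rho>_Ft \<alpha>_mult)
  have \<rho>_one: "\<rho> \<one>\<^bsub>G\<^esub> = id"
    by (simp add: \<rho>_F \<alpha>_one)
  have \<rho>_t: "\<rho> t = id"
    using \<rho>_Ft[OF F.one_closed] t(1) by (simp add: \<alpha>_one)
  have tS: "finite (insert t S)" "insert t S \<subseteq> H"
    using S(1) SF tH F.one_closed by (auto simp: H_def)
  obtain \<gamma> where \<gamma>: "\<gamma> \<in> cantor_actions G" "\<forall>s\<in>insert t S. \<forall>x. agree n (\<rho> s x) (\<gamma> s x)"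
    using approximate_extension[where \<rho> = \<rho> and n = n,
        OF G cnt H \<rho>_cont \<rho>_mult \<rho>_one tS] by blast
  show thesis
  proof (rule that[OF t(1) \<beta>(1) \<gamma>(1)])
    show "agree n (\<alpha> s x) (\<beta> s x)" if "s \<in> S" for s x
      using \<beta>(2) that by simp
    show "agree n (\<alpha> s x) (\<gamma> s x)" if "s \<in> S" for s x
      using \<gamma>(2) that SF \<rho>_F by (metis insertI2 subsetD)
    show "\<exists>x. agree n u x \<and> agree n v (\<beta> t x)" for u v
      using \<beta>(3) t(1,2) by blast
    show "agree n x (\<gamma> t x)" for x
      using \<gamma>(2) \<rho>_t by (metis insertI1 id_apply)
  qed
qed

section \<open>A conjugacy invariant with countably many values\<close>

definition displacing :: "('a, 'b) monoid_scheme \<Rightarrow> cantor set \<Rightarrow> ('a \<Rightarrow> cantor \<Rightarrow> cantor) \<Rightarrow> 'a set" where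
  "displacing G B \<alpha> = {g \<in> carrier G. \<not> \<alpha> g ` B \<subseteq> B}"

lemma displacing_conjugate_action:
  assumes "\<phi> \<in> cantor_homeos"
  shows "displacing G A (conjugate_action G \<phi> \<alpha>) = displacing G (\<phi> -` A) \<alpha>"
proof -
  obtain \<psi> where \<psi>: "\<psi> \<circ> \<phi> = id" "\<phi> \<circ> \<psi> = id"
    using assms unfolding cantor_homeos_iff by blast
  then have 1: "\<psi> (\<phi> x) = x" "\<phi> (\<psi> x) = x" for x
    by (simp_all add: fun_eq_iff)
  then have "inj \<phi>" by (metis injI)
  then have "inv_into UNIV \<phi> = \<psi>"
    using 1 by (metis inv_f_eq ext)
  then have "conjugate_action G \<phi> \<alpha> g ` A \<subseteq> A \<longleftrightarrow> \<alpha> g ` (\<phi> -` A) \<subseteq> \<phi> -` A"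
    if "g \<in> carrier G" for g
    using that 1 by (force simp: conjugate_action_def image_subset_iff)
  then show ?thesis
    unfolding displacing_def by blast
qed

text \<open>By uniform continuity of \<open>\<phi>\<close>, membership in the preimage depends only on the first \<open>m\<close>
  coordinates, so the preimage is described by a finite list of binary words of length \<open>m\<close>.\<close>

lemma countable_homeo_preimages:
  "countable {\<phi> -` {x. x 0} | \<phi>. \<phi> \<in> cantor_homeos}"
proof -
  define C where "C = (\<lambda>(m, L). {x :: cantor. map x [0..<m] \<in> set L})"
  have "\<phi> -` {x. x 0} \<in> range C" if "\<phi> \<in> cantor_homeos" for \<phi>
  proof -
    obtain m where m: "\<And>x y. agree m x y \<Longrightarrow> agree 1 (\<phi> x) (\<phi> y)"
      using \<open>\<phi> \<in> cantor_homeos\<close> unfolding cantor_homeos_iff continuous_cantor_iff by metis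
    define P where "P = (\<lambda>x. map x [0..<m]) ` (\<phi> -` {x. x 0})"
    have "P \<subseteq> {l. set l \<subseteq> UNIV \<and> length l = m}"
      by (auto simp: P_def)
    then have "finite P"
      by (rule finite_subset) (rule finite_lists_length_eq, simp)
    then obtain L where L: "set L = P"
      using finite_list by blast
    have "map x [0..<m] \<in> P \<longleftrightarrow> \<phi> x 0" for x
    proof
      assume "map x [0..<m] \<in> P"
      then obtain y where y: "\<phi> y 0" "map x [0..<m] = map y [0..<m]"
        by (auto simp: P_def)
      then have "agree m x y" by (simp add: agree_def)
      then show "\<phi> x 0" using m[of x y] y(1) by (simp add: agree_def)
    qed (auto simp: P_def)
    then have "\<phi> -` {x. x 0} = C (m, L)"
      unfolding C_def by (simp add: L vimage_def)
    then show ?thesis by blast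
  qed
  then have "{\<phi> -` {x. x 0} | \<phi>. \<phi> \<in> cantor_homeos} \<subseteq> range C" by blast
  then show ?thesis
    by (rule countable_subset) simp
qed

text \<open>Whether \<open>\<beta> g\<close> maps \<open>{x. x 0}\<close> into itself is decided by the coordinate \<open>0\<close> of its values, hence
  it does not change under a perturbation of \<open>\<beta> g\<close> by less than \<open>1\<close>.\<close>

lemma closedin_displacing_fibre:
  "closedin (action_topology G) {\<alpha> \<in> cantor_actions G. displacing G {x. x 0} \<alpha> = D}"
proof -
  have "\<exists>S n. finite S \<and> S \<subseteq> carrier G \<and>
        (\<forall>\<beta>\<in>cantor_actions G. (\<forall>s\<in>S. \<forall>x. agree n (\<alpha> s x) (\<beta> s x)) \<longrightarrow> displacing G {x. x 0} \<beta> \<noteq> D)"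
    if \<alpha>: "displacing G {x. x 0} \<alpha> \<noteq> D" for \<alpha>
  proof -
    obtain g where g: "(g \<in> displacing G {x. x 0} \<alpha>) \<noteq> (g \<in> D)"
      using \<alpha> by blast
    have "displacing G {x. x 0} \<beta> \<noteq> D"
      if "\<forall>s\<in>{g} \<inter> carrier G. \<forall>x. agree 1 (\<alpha> s x) (\<beta> s x)" for \<beta>
      using g that by (auto simp: displacing_def agree_def image_subset_iff)
    then show ?thesis
      by (intro exI[of _ "{g} \<inter> carrier G"] exI[of _ 1]) auto
  qed
  then have "openin (action_topology G)
      (cantor_actions G - {\<alpha> \<in> cantor_actions G. displacing G {x. x 0} \<alpha> = D})"
    unfolding openin_action_topology_iff by simp
  then show ?thesis
    unfolding closedin_def topspace_action_topology by auto
qed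

text \<open>Every neighbourhood contains two actions that disagree on whether some \<open>t\<close> is displacing, so it
  is not contained in a single fibre.\<close>

lemma hall_interior_displacing_fibre:
  assumes hall: "hall_universal_group G"
  shows "action_topology G interior_of
    {\<alpha> \<in> cantor_actions G. displacing G {x. x 0} \<alpha> = D} = {}"
proof (rule ccontr)
  assume "\<not> ?thesis"
  then obtain V \<alpha> where V: "openin (action_topology G) V" "\<alpha> \<in> V"
      "V \<subseteq> {\<alpha> \<in> cantor_actions G. displacing G {x. x 0} \<alpha> = D}"
    by (auto simp: interior_of_def)
  then obtain S n where S: "finite S" "S \<subseteq> carrier G"
    and SV: "\<forall>\<beta>\<in>cantor_actions G. (\<forall>s\<in>S. \<forall>x. agree n (\<alpha> s x) (\<beta> s x)) \<longrightarrow> \<beta> \<in> V"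
    unfolding openin_action_topology_iff by blast
  have \<alpha>: "\<alpha> \<in> cantor_actions G" using V by blast
  \<comment> \<open>\<open>Suc n\<close> makes sure that coordinate \<open>0\<close>, which defines the half space, is controlled.\<close>
  obtain t \<beta> \<gamma> where t: "t \<in> carrier G"
    and \<beta>\<gamma>: "\<beta> \<in> cantor_actions G" "\<gamma> \<in> cantor_actions G"
    "\<And>s x. s \<in> S \<Longrightarrow> agree (Suc n) (\<alpha> s x) (\<beta> s x)" "\<And>s x. s \<in> S \<Longrightarrow> agree (Suc n) (\<alpha> s x) (\<gamma> s x)"
    and \<beta>t: "\<And>u v. \<exists>x. agree (Suc n) u x \<and> agree (Suc n) v (\<beta> t x)"
    and \<gamma>t: "\<And>x. agree (Suc n) x (\<gamma> t x)"
    using hall_perturb_action[OF hall \<alpha> S(1,2), where n = "Suc n"] by blast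
  have "\<beta> \<in> V" "\<gamma> \<in> V"
    using \<beta>\<gamma> SV agree_mono[of "Suc n" _ _ n] by simp_all
  then have "displacing G {x. x 0} \<beta> = displacing G {x. x 0} \<gamma>"
    using V(3) by blast
  moreover have "t \<in> displacing G {x. x 0} \<beta>"
    using \<beta>t[of "\<lambda>_. True" "\<lambda>_. False"] t by (auto simp: displacing_def agree_def image_subset_iff)
  moreover have "t \<notin> displacing G {x. x 0} \<gamma>"
    using \<gamma>t by (auto simp: displacing_def agree_def)
  ultimately show False by blast
qed

section \<open>Meagerness of conjugacy classes\<close>

theorem corollary5p8:
  fixes G :: "('a, 'b) monoid_scheme"
  assumes "hall_universal_group G"
  shows "\<not> strong_topological_Rokhlin G"
proof
  let ?X = "action_topology G" and ?A = "{x :: cantor. x 0}"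
  have G: "group G" "countable (carrier G)"
    using assms by (auto simp: hall_universal_group_def locally_finite_group_def)
  assume "strong_topological_Rokhlin G"
  then obtain \<alpha> where \<alpha>: "\<alpha> \<in> cantor_actions G" "comeager_in ?X (conjugacy_class G \<alpha>)"
    by (auto simp: strong_topological_Rokhlin_def)
  then obtain \<F> where \<F>: "countable \<F>" "\<And>T. T \<in> \<F> \<Longrightarrow> nowhere_dense_in ?X T"
      "cantor_actions G - conjugacy_class G \<alpha> = \<Union>\<F>"
    unfolding comeager_in_def meager_in_def topspace_action_topology by blast
  define K where "K D = {\<beta> \<in> cantor_actions G. displacing G ?A \<beta> = D}" for D
  define \<B> where "\<B> = {\<phi> -` ?A | \<phi>. \<phi> \<in> cantor_homeos}"
  define \<G> where "\<G> = (\<lambda>T. ?X closure_of T) ` \<F> \<union> (\<lambda>B. K (displacing G B \<alpha>)) ` \<B>"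
  have "cantor_actions G \<subseteq> \<Union>\<G>"
  proof
    fix \<beta> assume \<beta>: "\<beta> \<in> cantor_actions G"
    show "\<beta> \<in> \<Union>\<G>"
    proof (cases "\<beta> \<in> conjugacy_class G \<alpha>")
      case True
      then obtain \<phi> where "\<phi> \<in> cantor_homeos" "\<beta> = conjugate_action G \<phi> \<alpha>"
        by (auto simp: conjugacy_class_def)
      then have "\<beta> \<in> K (displacing G (\<phi> -` ?A) \<alpha>)" "\<phi> -` ?A \<in> \<B>"
        using \<beta> displacing_conjugate_action[of \<phi> G ?A \<alpha>] by (auto simp: K_def \<B>_def)
      then show ?thesis by (auto simp: \<G>_def)
    next
      case False
      then obtain T where T: "T \<in> \<F>" "\<beta> \<in> T" using \<F>(3) \<beta> by blast
      then have "\<beta> \<in> ?X closure_of T"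
        using \<F>(2) closure_of_subset[of T ?X] by (auto simp: nowhere_dense_in_def)
      then show ?thesis using T(1) by (auto simp: \<G>_def)
    qed
  qed
  moreover have "?X interior_of \<Union>\<G> = {}"
  proof (rule Baire_category_alt)
    show "completely_metrizable_space ?X \<or> locally_compact_space ?X \<and> regular_space ?X"
      using completely_metrizable_action_topology[OF G] by blast
    show "countable \<G>"
      using \<F>(1) countable_homeo_preimages by (simp add: \<G>_def \<B>_def)
    show "closedin ?X T \<and> ?X interior_of T = {}" if "T \<in> \<G>" for T
      using that \<F>(2) closedin_displacing_fibre hall_interior_displacing_fibre[OF assms]
      unfolding \<G>_def K_def nowhere_dense_in_def by (auto simp: closedin_closure_of)
  qed
  ultimately have "?X interior_of (cantor_actions G) = {}"
    using interior_of_mono[of "cantor_actions G" "\<Union>\<G>" ?X] by blast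
  then show False
    using \<alpha>(1) interior_of_topspace[of ?X] by (simp add: topspace_action_topology)
qed

end
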